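(* Let $V^{(m^1)^\infty},\dots,V^{(m^r)^\infty},V^{(m)^\infty}$ be irreducible tame representations of $G_\infty=U(\infty)$ with bases of state vectors $\{f^{m^i}_{\xi_i}\}_{\xi_i}$ ($1\le i\le r$) and $\{f^m_\xi\}_\xi$, and let $\{f^{m^*}_{\xi^*}\}_{\xi^*}$ be the corresponding basis of state vectors of the contragredient representation $V^{(m^\vee)^\infty}$. Let $\{\mathcal I_\eta\}_\eta$ be a basis of the space of $G_\infty$-invariants contained (in the inverse limit sense) in $V^{(m^1)^\infty}\otimes\cdots\otimes V^{(m^r)^\infty}\otimes V^{(m^\vee)^\infty}$. Set $$\tilde f^{m,\eta}_\xi(Z)=\langle\mathcal I_\eta(Z,w)\,|\,f^{m^*}_{\xi^*}(w)\rangle_w=\mathcal I_\eta(Z,D)\,\overline{f^{m^*}_{\xi^*}(\bar w)}\Big|_{w=0}.$$ Then, for each $\eta$, $\{\tilde f^{m,\eta}_\xi\}_\xi$ is an isomorphic image of $\{f^m_\xi\}_\xi$ in $V^{(m^1)^\infty}\otimes\cdots\otimes V^{(m^r)^\infty}$ (indexed by the multiplicity label $\eta$), and $$\langle\tilde f^{m,\eta}_\xi\,|\,f^{m^1}_{\xi_1}f^{m^2}_{\xi_2}\cdots f^{m^r}_{\xi_r}\rangle=\langle\mathcal I_\eta\,|\,f^{m^1}_{\xi_1}f^{m^2}_{\xi_2}\cdots f^{m^r}_{\xi_r}f^{m^*}_{\xi^*}\rangle$$ for all $\eta,\xi,\xi_1,\dots,\xi_r$.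
   Context: $G_k=U(k)$, embedded in $G_{k+1}$ by $g\mapsto\begin{pmatrix}g&0\\0&1\end{pmatrix}$; $G_\infty=\bigcup_kG_k$; $g^\vee=(g^{-1})^T$. The signatures are $(m^i_1,\dots,m^i_{p_i},0,0,\dots)$, $1\le i\le r$, and $(m_1,\dots,m_q,0,0,\dots)$, with nonincreasing nonnegative integer entries; $p=p_1+\dots+p_r$, $n=p+q$. Realization. For $k\ge n$ the irreducible $G_k$-module $V^{(m^i)^k}$ of highest weight $(m^i_1,\dots,m^i_{p_i},0,\dots,0)$ is the space of polynomials $f$ on $\mathbb C^{p_i\times k}$ with $f(bZ)=b_{11}^{m^i_1}\cdots b_{p_ip_i}^{m^i_{p_i}}f(Z)$ for all invertible lower triangular $b$, with action $f(Z)\mapsto f(Zg)$; similarly for $V^{(m)^k}$ on $\mathbb C^{q\times k}$ (action denoted $R^{(m)}$). The contragredient module $V^{(m^\vee)^k}$ is the space of polynomials $f$ on $\mathbb C^{q\times k}\ni w$ with $f(bw)=b_{11}^{m_1}\cdots b_{qq}^{m_q}f(w)$ for all invertible lower triangular $b$, with action $[R^{(m)\vee}(g)f](w)=f(wg^\vee)$. Functions of $k$ columns are regarded as functions of $k+1$ columns not depending on the last column; the modules $V^{(\cdot)^\infty}$, and their tensor products with diagonal $G_\infty$-action, are the resulting inductive limits (unions, completed with respect to the inner product). Tensor products are realized as spaces of functions of $(Z,w)$, with $Z$ the matrix with row blocks $Z^1,\dots,Z^r$, $Z^i\in\mathbb C^{p_i\times k}$; a tensor $f_1\otimes\cdots\otimes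 f_r\otimes f$ is the product function $f_1(Z^1)\cdots f_r(Z^r)f(w)$. Bases of state vectors. These are bases consisting of polynomial vectors, i.e. (algebraic) bases of $\bigcup_kV^{(\cdot)^k}$ (for example generalized Gelfand–Zetlin bases). For $g\in G_\infty$ write $R^{(m)}(g)f^m_\xi=\sum_{\xi'}\mathcal D^m_{\xi\xi'}(g)f^m_{\xi'}$. The basis $\{f^{m^*}_{\xi^*}\}$ of the contragredient, indexed in correspondence $\xi\leftrightarrow\xi^*$, satisfies $R^{(m)\vee}(g)f^{m^*}_{\xi^*}=\sum_{\xi'}\overline{\mathcal D^m_{\xi\xi'}(g)}\,f^{m^*}_{\xi'^*}$. Invariants. Let $T_k=V^{(m^1)^k}\otimes\cdots\otimes V^{(m^r)^k}\otimes V^{(m^\vee)^k}$ for $k\ge n$, and let $\phi^k_j:T_k\to T_j$ ($j\le k$) set all variables in columns $j+1,\dots,k$ to $0$. The space of $G_\infty$-invariants "contained in" the augmented tensor product is $\varprojlim_kT_k^{G_k}$, the inverse limit of the spaces of $G_k$-invariants; its elements are the polynomials (finite sums of products) in the formal series $P_{\alpha\beta}=\sum_{t=1}^\infty Z_{\alpha t}w_{\beta t}$ ($1\le\alpha\le p$, $1\le\beta\le q$) whose truncations lie in $T_k$ for all $k\ge n$. Pairings. For polynomials $f_1,f_2$, $\langle f_1|f_2\rangle=f_1(D)\overline{f_2(\bar Z)}|_{Z=0}$, where $f_1(D)$ replaces each variable by the corresponding partial derivative (in all the variables $Z,w$ if both occur). If $\mathcal I$ is such a formal series and $f$ is a polynomial,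 $\langle\mathcal I|f\rangle$ is defined by the same formula; terms of $\mathcal I$ involving columns on which $f$ does not depend contribute $0$. $\mathcal I_\eta(Z,D)$ means that only the $w$-variables are replaced by derivatives, so $\langle\mathcal I_\eta|f\rangle_w$ is a polynomial in $Z$. "Isomorphic image": each $\tilde f^{m,\eta}_\xi$ lies in $V^{(m^1)^\infty}\otimes\cdots\otimes V^{(m^r)^\infty}$, and $f^m_\xi\mapsto\tilde f^{m,\eta}_\xi$ defines a $G_\infty$-equivariant linear isomorphism of $\mathrm{span}\{f^m_\xi\}$ onto its image, so that the $\tilde f^{m,\eta}_\xi$ transform with the same functions $\mathcal D^m_{\xi\xi'}$ under $f(Z)\mapsto f(Zg)$. *)

theory Defs
  imports
    Complex_Main
    "HOL-Library.Poly_Mapping"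
    "HOL-Library.Function_Algebras"
    "HOL-Algebra.Group"
begin

section \<open>Polynomials and formal series in matrix entries\<close>

text \<open>
  Rows and columns are numbered from \<open>0\<close>.  A variable is a pair of a row label and a column
  number, so a polynomial in the entries of a matrix with arbitrarily many columns does not
  mention the number of columns, and a polynomial in \<open>k\<close> columns is already a polynomial in
  \<open>k + 1\<close> columns that does not depend on the last one.  The coefficient function of a
  polynomial \<open>f\<close> is \<open>Poly_Mapping.lookup f\<close>; dropping finiteness of the support gives formal series.
\<close>

type_synonym 'v mono = "'v \<Rightarrow>\<^sub>0 nat"
type_synonym 'v pol = "'v mono \<Rightarrow>\<^sub>0 complex"
type_synonym 'v ser = "'v mono \<Rightarrow> complex"

definition Var :: "'v \<Rightarrow> 'v pol" where
  "Var v = Poly_Mapping.single (Poly_Mapping.single v 1) 1"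

definition smul :: "complex \<Rightarrow> 'v pol \<Rightarrow> 'v pol"  (infixr \<open>*\<^sub>P\<close> 75) where
  "c *\<^sub>P f = Poly_Mapping.single 0 c * f"

definition ser_smul :: "complex \<Rightarrow> 'v ser \<Rightarrow> 'v ser" where
  "ser_smul c F = (\<lambda>a. c * F a)"

global_interpretation pol: vector_space "smul :: complex \<Rightarrow> 'v pol \<Rightarrow> 'v pol"
  by unfold_locales
    (simp_all add: smul_def distrib_left distrib_right single_add mult_single
      flip: mult.assoc)

global_interpretation ser: vector_space "ser_smul :: complex \<Rightarrow> 'v ser \<Rightarrow> 'v ser"
  by unfold_locales (auto simp: ser_smul_def algebra_simps)

definition is_basis ::
    "(complex \<Rightarrow> 'b \<Rightarrow> 'b::ab_group_add) \<Rightarrow> 'b set \<Rightarrow> ('i \<Rightarrow> 'b) \<Rightarrow> 'i set \<Rightarrow> bool" where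
  "is_basis scale S f I \<longleftrightarrow>
     inj_on f I \<and> \<not> module.dependent scale (f ` I) \<and> module.span scale (f ` I) = S"

definition vars :: "'v pol \<Rightarrow> 'v set" where
  "vars f = (\<Union>a \<in> Poly_Mapping.keys f. Poly_Mapping.keys a)"

definition subst :: "('v \<Rightarrow> 'u pol) \<Rightarrow> 'v pol \<Rightarrow> 'u pol" where
  "subst \<sigma> f = (\<Sum>a \<in> Poly_Mapping.keys f.
     Poly_Mapping.lookup f a *\<^sub>P (\<Prod>v \<in> Poly_Mapping.keys a. \<sigma> v ^ Poly_Mapping.lookup a v))"

definition rename :: "('v \<Rightarrow> 'u) \<Rightarrow> 'v pol \<Rightarrow> 'u pol" where
  "rename h = subst (\<lambda>v. Var (h v))"

text \<open>Coefficientwise conjugation, i.e. the polynomial \<open>Z \<mapsto> cnj (f (cnj Z))\<close>.\<close>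
definition conj_pol :: "'v pol \<Rightarrow> 'v pol" where
  "conj_pol f = Poly_Mapping.map cnj f"

definition partial :: "'v \<Rightarrow> 'v pol \<Rightarrow> 'v pol" where
  "partial v f = (\<Sum>a \<in> Poly_Mapping.keys f.
     Poly_Mapping.single (a - Poly_Mapping.single v 1)
       (of_nat (Poly_Mapping.lookup a v) * Poly_Mapping.lookup f a))"

definition partial_mono :: "'v mono \<Rightarrow> 'v pol \<Rightarrow> 'v pol" where
  "partial_mono a f =
     Finite_Set.fold (\<lambda>v. partial v ^^ Poly_Mapping.lookup a v) f (Poly_Mapping.keys a)"

definition at_zero :: "'v pol \<Rightarrow> complex" where
  "at_zero f = Poly_Mapping.lookup f 0"

text \<open>
  The pairing \<open>F(D) cnj (f (cnj Z))\<close> at \<open>Z = 0\<close>, for a formal series \<open>F\<close>.  Only monomials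
  occurring in \<open>f\<close> contribute, so the sum has finitely many nonzero terms.
\<close>
definition pairing_ser :: "'v ser \<Rightarrow> 'v pol \<Rightarrow> complex" where
  "pairing_ser F f = Sum_any (\<lambda>a. F a * at_zero (partial_mono a (conj_pol f)))"

definition pairing :: "'v pol \<Rightarrow> 'v pol \<Rightarrow> complex" where
  "pairing f1 f2 = pairing_ser (Poly_Mapping.lookup f1) f2"

section \<open>The group \<open>U(\<infinity>)\<close>\<close>

text \<open>
  A matrix in \<open>U(k)\<close> is stored with its extension by the identity, which makes the embeddings
  of \<open>U(k)\<close> into \<open>U(k + 1)\<close> inclusions.
\<close>

definition Umat :: "nat \<Rightarrow> (nat \<Rightarrow> nat \<Rightarrow> complex) set" where
  "Umat k = {g.
     (\<forall>s t. k \<le> s \<or> k \<le> t \<longrightarrow> g s t = (if s = t then 1 else 0)) \<and>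
     (\<forall>s<k. \<forall>t<k. (\<Sum>u<k. g s u * cnj (g t u)) = (if s = t then 1 else 0)) \<and>
     (\<forall>s<k. \<forall>t<k. (\<Sum>u<k. cnj (g u s) * g u t) = (if s = t then 1 else 0))}"

definition U_inf :: "(nat \<Rightarrow> nat \<Rightarrow> complex) monoid" where
  "U_inf = \<lparr>carrier = (\<Union>k. Umat k),
     monoid.mult = (\<lambda>g h s t. \<Sum>u | g s u \<noteq> 0. g s u * h u t),
     one = (\<lambda>s t. if s = t then 1 else 0)\<rparr>"

definition contra :: "(nat \<Rightarrow> nat \<Rightarrow> complex) \<Rightarrow> nat \<Rightarrow> nat \<Rightarrow> complex" where
  "contra g = (\<lambda>s t. (inv\<^bsub>U_inf\<^esub> g) t s)"

text \<open>The entry at \<open>(\<rho>, t)\<close> of \<open>Z g\<close>, where \<open>Z\<close> is the matrix of variables.\<close>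
definition entry_mult :: "(nat \<Rightarrow> nat \<Rightarrow> complex) \<Rightarrow> 'r \<times> nat \<Rightarrow> ('r \<times> nat) pol" where
  "entry_mult g = (\<lambda>(\<rho>, t). \<Sum>s | g s t \<noteq> 0. g s t *\<^sub>P Var (\<rho>, s))"

definition act :: "(nat \<Rightarrow> nat \<Rightarrow> complex) \<Rightarrow> ('r \<times> nat) pol \<Rightarrow> ('r \<times> nat) pol" where
  "act g = subst (entry_mult g)"

definition act_dual :: "(nat \<Rightarrow> nat \<Rightarrow> complex) \<Rightarrow> ('r \<times> nat) pol \<Rightarrow> ('r \<times> nat) pol" where
  "act_dual g = act (contra g)"

text \<open>\<open>A g f\<^sub>\<xi> = (\<Sum>\<xi>'. D g \<xi> \<xi>' f\<^sub>\<xi>')\<close> for all \<open>g\<close> in \<open>U(\<infinity>)\<close>, with finite sums.\<close>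
definition transforms_by ::
    "((nat \<Rightarrow> nat \<Rightarrow> complex) \<Rightarrow> 'v pol \<Rightarrow> 'v pol) \<Rightarrow> 'x set \<Rightarrow> ('x \<Rightarrow> 'v pol) \<Rightarrow>
     ((nat \<Rightarrow> nat \<Rightarrow> complex) \<Rightarrow> 'x \<Rightarrow> 'x \<Rightarrow> complex) \<Rightarrow> bool" where
  "transforms_by A \<Xi> f D \<longleftrightarrow>
     (\<forall>g \<in> carrier U_inf. \<forall>\<xi> \<in> \<Xi>.
        finite {\<xi>' \<in> \<Xi>. D g \<xi> \<xi>' \<noteq> 0} \<and>
        A g (f \<xi>) = (\<Sum>\<xi>' | \<xi>' \<in> \<Xi> \<and> D g \<xi> \<xi>' \<noteq> 0. D g \<xi> \<xi>' *\<^sub>P f \<xi>'))"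

section \<open>Irreducible modules and their tensor products\<close>

text \<open>A signature \<open>(m\<^sub>1, \<dots>, m\<^sub>p, 0, 0, \<dots>)\<close> is given by the list \<open>[m\<^sub>1, \<dots>, m\<^sub>p]\<close>.\<close>

definition signature :: "nat list \<Rightarrow> bool" where
  "signature m \<longleftrightarrow> sorted_wrt (\<ge>) m"

definition inv_lower_triangular :: "nat \<Rightarrow> (nat \<Rightarrow> nat \<Rightarrow> complex) \<Rightarrow> bool" where
  "inv_lower_triangular p b \<longleftrightarrow>
     (\<forall>\<alpha><p. \<forall>\<beta><p. \<alpha> < \<beta> \<longrightarrow> b \<alpha> \<beta> = 0) \<and>
     (\<exists>c. \<forall>\<alpha><p. \<forall>\<beta><p.
        (\<Sum>\<gamma><p. b \<alpha> \<gamma> * c \<gamma> \<beta>) = (if \<alpha> = \<beta> then 1 else 0) \<and>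
        (\<Sum>\<gamma><p. c \<alpha> \<gamma> * b \<gamma> \<beta>) = (if \<alpha> = \<beta> then 1 else 0))"

text \<open>
  The space underlying both the irreducible \<open>U(k)\<close>-module of highest weight \<open>m\<close> (with action
  \<^const>\<open>act\<close>) and its contragredient (with action \<^const>\<open>act_dual\<close>).
\<close>
definition Vmod :: "nat list \<Rightarrow> nat \<Rightarrow> (nat \<times> nat) pol set" where
  "Vmod m k = {f. vars f \<subseteq> {..<length m} \<times> {..<k} \<and>
     (\<forall>b. inv_lower_triangular (length m) b \<longrightarrow>
        subst (\<lambda>(\<alpha>, t). \<Sum>\<beta><length m. b \<alpha> \<beta> *\<^sub>P Var (\<beta>, t)) f
          = (\<Prod>\<alpha><length m. b \<alpha> \<alpha> ^ (m ! \<alpha>)) *\<^sub>P f)}"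

text \<open>
  The polynomial vectors of the inductive limit.  Its Hilbert space completion is not needed:
  every vector considered below is a polynomial.
\<close>
definition V_inf :: "nat list \<Rightarrow> (nat \<times> nat) pol set" where
  "V_inf m = (\<Union>k. Vmod m k)"

text \<open>
  Row \<open>a\<close> of the block \<open>Z\<^sup>i\<close> has label \<open>(i, a)\<close>; in polynomials in \<open>(Z, w)\<close> the rows of \<open>Z\<close>
  are tagged with \<^const>\<open>Inl\<close> and those of \<open>w\<close> with \<^const>\<open>Inr\<close>.
\<close>
type_synonym zvar = "(nat \<times> nat) \<times> nat"
type_synonym zwvar = "(nat \<times> nat + nat) \<times> nat"

definition z_tag :: "zvar \<Rightarrow> zwvar" where
  "z_tag = (\<lambda>(\<rho>, t). (Inl \<rho>, t))"

definition w_tag :: "nat \<times> nat \<Rightarrow> zwvar" where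
  "w_tag = (\<lambda>(\<beta>, t). (Inr \<beta>, t))"

definition tensor_z :: "nat \<Rightarrow> (nat \<Rightarrow> (nat \<times> nat) pol) \<Rightarrow> zvar pol" where
  "tensor_z r F = (\<Prod>i<r. rename (\<lambda>(a, t). ((i, a), t)) (F i))"

definition tensor_zw :: "zvar pol \<Rightarrow> (nat \<times> nat) pol \<Rightarrow> zwvar pol" where
  "tensor_zw u f = rename z_tag u * rename w_tag f"

definition VZ :: "nat list list \<Rightarrow> nat \<Rightarrow> zvar pol set" where
  "VZ ms k = pol.span {tensor_z (length ms) F | F. \<forall>i<length ms. F i \<in> Vmod (ms ! i) k}"

definition VZ_inf :: "nat list list \<Rightarrow> zvar pol set" where
  "VZ_inf ms = (\<Union>k. VZ ms k)"

definition Tmod :: "nat list list \<Rightarrow> nat list \<Rightarrow> nat \<Rightarrow> zwvar pol set" where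
  "Tmod ms m k = pol.span
     {tensor_zw (tensor_z (length ms) F) f | F f.
        (\<forall>i<length ms. F i \<in> Vmod (ms ! i) k) \<and> f \<in> Vmod m k}"

definition act_zw :: "(nat \<Rightarrow> nat \<Rightarrow> complex) \<Rightarrow> zwvar pol \<Rightarrow> zwvar pol" where
  "act_zw g = subst (\<lambda>(\<rho>, t).
     case \<rho> of Inl _ \<Rightarrow> entry_mult g (\<rho>, t) | Inr _ \<Rightarrow> entry_mult (contra g) (\<rho>, t))"

section \<open>Invariants\<close>

text \<open>Setting all variables in columns \<open>k, k + 1, \<dots>\<close> to \<open>0\<close> deletes the monomials containing them.\<close>
definition truncate :: "nat \<Rightarrow> ('r \<times> nat) ser \<Rightarrow> ('r \<times> nat) ser" where
  "truncate k F = (\<lambda>a. if \<forall>v \<in> Poly_Mapping.keys a. snd v < k then F a else 0)"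

text \<open>
  The inverse limit over \<open>k \<ge> n = p + q\<close> of the spaces of \<open>U(k)\<close>-invariants in \<open>Tmod ms m k\<close>.  A
  compatible family of polynomials is the same as the formal series of which they are the
  truncations: the coefficient of any monomial is eventually constant along the family.
\<close>
definition invariants :: "nat list list \<Rightarrow> nat list \<Rightarrow> zwvar ser set" where
  "invariants ms m = {I. \<forall>k \<ge> sum_list (map length ms) + length m.
     \<exists>t \<in> Tmod ms m k. (\<forall>g \<in> Umat k. act_zw g t = t) \<and> Poly_Mapping.lookup t = truncate k I}"

text \<open>
  The partial pairing \<open>I(Z, D) cnj (f (cnj w))\<close> at \<open>w = 0\<close>.  A monomial of \<open>I\<close> is split into
  its part in \<open>Z\<close> and its part in \<open>w\<close>.  For \<open>I\<close> in \<^const>\<open>invariants\<close> the sum has finitely many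
  nonzero terms, since each monomial of \<open>I\<close> has equal degrees in column \<open>t\<close> of \<open>Z\<close> and of \<open>w\<close>.
\<close>
definition pairing_w :: "zwvar ser \<Rightarrow> (nat \<times> nat) pol \<Rightarrow> zvar pol" where
  "pairing_w I f = Sum_any (\<lambda>c.
     Poly_Mapping.single (Poly_Mapping.map_key z_tag c)
       (I c * at_zero (partial_mono (Poly_Mapping.map_key w_tag c) (conj_pol f))))"

end

theory Submission
  imports Defs
begin

text \<open>
  The pairing is invariant under unitary substitutions, so contracting an invariant with a vector of
  the contragredient module intertwines the actions, and the torus reduces every statement about a
  formal series to one about a truncation \<open>t\<close> in finitely many columns, where it can be checked on
  product tensors.  What remains is injectivity, i.e. irreducibility.  A nonzero \<open>U(k)\<close>-invariant
  subspace contains a polynomial that does not vanish at the matrix \<open>(1 0)\<close>, because each matrix is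
  a lower triangular one times a unitary one.  Its component of weight \<open>m\<close> under the torus has
  the same value there, and a polynomial of weight \<open>m\<close> is determined by this value.  Hence any two
  nonzero invariant subspaces intersect, whereas the kernel of the contraction with \<open>t\<close> and its
  orthogonal complement, which contains the coefficients of \<open>t\<close>, do not.
\<close>

section \<open>Evaluation of polynomials\<close>

text \<open>Polynomials are handled through their values at all points: a substitution becomes
  composition with a map of points, so identities between actions become matrix identities.
  Coefficients are recovered by one independence argument for characters. It is stated modulo a
  subspace because it is used twice: modulo 0 it shows that values determine a polynomial, and
  modulo an invariant subspace it shows that this subspace contains the weight components of its
  elements. Conjugation shapes the final map. The contraction is conjugate linear in the dual
  vector, so the coefficients \<open>cnj (D g \<xi> \<xi>')\<close> of the dual basis come out as
  \<open>D g \<xi> \<xi>'\<close>, and a linear combination of the \<open>f \<xi>\<close> has to be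
  matched with the combination of the \<open>fstar \<xi>\<close> with conjugated coefficients. The
  transformation law in \<open>Vmod\<close> concerns invertible lower triangular matrices only,
  whereas the matrices at which a polynomial is evaluated may be singular. Row degrees and limits
  along vanishing pivots cover these cases.\<close>

abbreviation (input) lookup :: "('a \<Rightarrow>\<^sub>0 'b::zero) \<Rightarrow> 'a \<Rightarrow> 'b" where
  "lookup \<equiv> Poly_Mapping.lookup"

abbreviation (input) keys :: "('a \<Rightarrow>\<^sub>0 'b::zero) \<Rightarrow> 'a set" where
  "keys \<equiv> Poly_Mapping.keys"

abbreviation (input) single :: "'a \<Rightarrow> 'b \<Rightarrow> 'a \<Rightarrow>\<^sub>0 'b::zero" where
  "single \<equiv> Poly_Mapping.single"

lemma sum_single_keys: "(\<Sum>a\<in>keys f. single a (lookup f a)) = f"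
  by (rule poly_mapping_eqI)
    (simp add: lookup_sum lookup_single when_def sum.delta' in_keys_iff)

lemma pol_induct [case_names single add]:
  fixes f :: "'a \<Rightarrow>\<^sub>0 'b::comm_monoid_add"
  assumes "\<And>a c. P (single a c)" and "\<And>f g. P f \<Longrightarrow> P g \<Longrightarrow> P (f + g)"
  shows "P f"
proof -
  have "P 0" using assms(1)[of undefined 0] by simp
  have "P (\<Sum>a\<in>A. single a (lookup f a))" if "finite A" for A
    using that \<open>P 0\<close> assms by (induction A) auto
  from this[OF finite_keys[of f]] show ?thesis by (simp add: sum_single_keys)
qed

text \<open>Plays two roles: the value of the monomial \<open>a\<close> at the point
  \<open>x\<close>, and, for fixed \<open>a\<close>, a multiplicative character in \<open>x\<close>.
  In the second role it describes torus weights.\<close>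

definition mon :: "('v \<Rightarrow> complex) \<Rightarrow> 'v mono \<Rightarrow> complex" where
  "mon x a = (\<Prod>v\<in>keys a. x v ^ lookup a v)"

lemma mon_superset: "finite S \<Longrightarrow> keys a \<subseteq> S \<Longrightarrow> mon x a = (\<Prod>v\<in>S. x v ^ lookup a v)"
  unfolding mon_def by (rule prod.mono_neutral_left) (auto simp: in_keys_iff)

lemma mon_0 [simp]: "mon x 0 = 1"
  by (simp add: mon_def)

lemma mon_single [simp]: "mon x (single v n) = x v ^ n"
  by (simp add: mon_def)

lemma mon_add: "mon x (a + b) = mon x a * mon x b"
proof -
  let ?S = "keys a \<union> keys b"
  have "keys (a + b) \<subseteq> ?S" by (rule keys_add)
  then show ?thesis
    by (simp add: mon_superset[of ?S] lookup_add power_add prod.distrib)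
qed

lemma mon_mult: "mon (\<lambda>v. x v * y v) a = mon x a * mon y a"
  by (simp add: mon_def power_mult_distrib prod.distrib)

lemma mon_one [simp]: "mon (\<lambda>v. 1) a = 1"
  by (simp add: mon_def)

lemma mon_cong: "(\<And>v. v \<in> keys a \<Longrightarrow> x v = y v) \<Longrightarrow> mon x a = mon y a"
  by (simp add: mon_def)

text \<open>A point with a single coordinate different from 1 isolates one exponent; this is how
  distinct monomials are told apart.\<close>

lemma mon_update_one: "mon ((\<lambda>_. 1)(v := c)) a = c ^ lookup a v"
proof -
  have "mon ((\<lambda>_. 1)(v := c)) a = (\<Prod>u\<in>insert v (keys a). ((\<lambda>_. 1)(v := c)) u ^ lookup a u)"
    by (rule mon_superset) auto
  also have "\<dots> = c ^ lookup a v * (\<Prod>u\<in>keys a - {v}. 1)"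
    by (subst prod.insert_remove) (auto intro!: prod.cong)
  finally show ?thesis by simp
qed

definition ev :: "('v \<Rightarrow> complex) \<Rightarrow> 'v pol \<Rightarrow> complex" where
  "ev z f = (\<Sum>a\<in>keys f. lookup f a * mon z a)"

lemma ev_superset: "finite S \<Longrightarrow> keys f \<subseteq> S \<Longrightarrow> ev z f = (\<Sum>a\<in>S. lookup f a * mon z a)"
  unfolding ev_def by (rule sum.mono_neutral_left) (auto simp: in_keys_iff)

lemma ev_0 [simp]: "ev z 0 = 0"
  by (simp add: ev_def)

lemma ev_add [simp]: "ev z (f + g) = ev z f + ev z g"
proof -
  let ?S = "keys f \<union> keys g"
  have "keys (f + g) \<subseteq> ?S" by (rule keys_add)
  then show ?thesis
    by (simp add: ev_superset[of ?S] lookup_add distrib_right sum.distrib)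
qed

lemma ev_single [simp]: "ev z (single a c) = c * mon z a"
  by (simp add: ev_def)

lemma ev_1 [simp]: "ev z 1 = 1"
  using ev_single[of z 0 1] by (simp del: ev_single)

lemma ev_mult [simp]: "ev z (f * g) = ev z f * ev z g"
proof (induction f rule: pol_induct)
  case (single a c)
  show ?case
    by (induction g rule: pol_induct) (simp_all add: mult_single mon_add algebra_simps)
qed (simp add: distrib_right)

lemma ev_smul [simp]: "ev z (c *\<^sub>P f) = c * ev z f"
  by (simp add: smul_def)

lemma ev_Var [simp]: "ev z (Var v) = z v"
  by (simp add: Var_def)

lemma ev_sum [simp]: "ev z (sum F A) = (\<Sum>x\<in>A. ev z (F x))"
  by (induction A rule: infinite_finite_induct) auto

lemma ev_prod [simp]: "ev z (prod F A) = (\<Prod>x\<in>A. ev z (F x))"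
  by (induction A rule: infinite_finite_induct) auto

lemma ev_power [simp]: "ev z (f ^ n) = ev z f ^ n"
  by (induction n) auto

lemma ev_minus [simp]: "ev z (f - g) = ev z f - ev z g"
  using ev_add[of z "f - g" g] by (simp del: ev_add)

text \<open>At the level of points a substitution is a composition of maps. Together with
  \<open>pol_eqI_ev\<close> this reduces identities between nested substitutions to identities
  between points.\<close>

lemma ev_subst [simp]: "ev z (subst \<sigma> f) = ev (\<lambda>v. ev z (\<sigma> v)) f"
  by (simp add: subst_def ev_def[where f = f] mon_def)

lemma ev_rename [simp]: "ev z (rename h f) = ev (\<lambda>v. z (h v)) f"
  by (simp add: rename_def)

lemma ev_cong: "(\<And>v. v \<in> vars f \<Longrightarrow> x v = y v) \<Longrightarrow> ev x f = ev y f"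
  unfolding ev_def by (intro sum.cong arg_cong2[where f="(*)"] mon_cong refl) (auto simp: vars_def)

lemma lookup_smul [simp]: "lookup (c *\<^sub>P f) a = c * lookup f a"
proof (induction f rule: pol_induct)
  case (single b d)
  then show ?case by (simp add: smul_def mult_single lookup_single when_def)
qed (simp add: pol.scale_right_distrib lookup_add algebra_simps)

text \<open>Dedekind's argument for the independence of characters, carried out modulo a subspace.\<close>
lemma characters_independent_mod:
  fixes \<chi> :: "'w \<Rightarrow> 'd \<Rightarrow> complex" and F :: "'w \<Rightarrow> 'v pol"
  assumes K: "pol.subspace K" and "finite W"
    and closed: "\<And>x y. x \<in> T \<Longrightarrow> y \<in> T \<Longrightarrow> m x y \<in> T"
    and mult: "\<And>w x y. w \<in> W \<Longrightarrow> x \<in> T \<Longrightarrow> y \<in> T \<Longrightarrow> \<chi> w (m x y) = \<chi> w x * \<chi> w y"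
    and one: "e \<in> T" "\<And>w. w \<in> W \<Longrightarrow> \<chi> w e = 1"
    and dist: "\<And>w w'. w \<in> W \<Longrightarrow> w' \<in> W \<Longrightarrow> w \<noteq> w' \<Longrightarrow> \<exists>x\<in>T. \<chi> w x \<noteq> \<chi> w' x"
    and sum: "\<And>x. x \<in> T \<Longrightarrow> (\<Sum>w\<in>W. \<chi> w x *\<^sub>P F w) \<in> K"
    and "w \<in> W"
  shows "F w \<in> K"
  using assms(2,4,6-)
proof (induction W arbitrary: F w rule: finite_induct)
  case (insert w0 W)
  have mem: "F w \<in> K" if w: "w \<in> W" for w
  proof -
    obtain y where y: "y \<in> T" "\<chi> w y \<noteq> \<chi> w0 y"
      using insert.prems(3)[of w w0] insert.hyps w by (metis insert_iff)
    \<comment> \<open>Subtracting \<open>\<chi> w0 y\<close> times the relation at \<open>x\<close>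
      from the relation at \<open>m x y\<close> removes the term of \<open>w0\<close> and rescales
      the others by these factors.\<close>
    have "(\<chi> w y - \<chi> w0 y) *\<^sub>P F w \<in> K"
    proof (rule insert.IH[where F = "\<lambda>w. (\<chi> w y - \<chi> w0 y) *\<^sub>P F w"])
      fix x assume x: "x \<in> T"
      have "(\<Sum>w\<in>insert w0 W. \<chi> w (m x y) *\<^sub>P F w)
          - \<chi> w0 y *\<^sub>P (\<Sum>w\<in>insert w0 W. \<chi> w x *\<^sub>P F w) \<in> K"
        by (intro pol.subspace_diff[OF K] pol.subspace_scale[OF K] insert.prems closed x y)
      also have "(\<Sum>w\<in>insert w0 W. \<chi> w (m x y) *\<^sub>P F w)
          = (\<Sum>w\<in>insert w0 W. (\<chi> w x * \<chi> w y) *\<^sub>P F w)"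
        by (intro sum.cong refl) (simp add: insert.prems x y del: insert_iff)
      also have "\<dots> - \<chi> w0 y *\<^sub>P (\<Sum>w\<in>insert w0 W. \<chi> w x *\<^sub>P F w)
          = (\<Sum>w\<in>insert w0 W. \<chi> w x *\<^sub>P ((\<chi> w y - \<chi> w0 y) *\<^sub>P F w))"
        unfolding pol.scale_sum_right sum_subtractf[symmetric]
        by (intro sum.cong refl) (simp add: pol.scale_left_diff_distrib pol.scale_right_diff_distrib mult.commute)
      finally show "(\<Sum>w\<in>W. \<chi> w x *\<^sub>P ((\<chi> w y - \<chi> w0 y) *\<^sub>P F w)) \<in> K"
        using insert.hyps by simp
    qed (use insert.prems w in auto)
    from pol.subspace_scale[OF K this, of "inverse (\<chi> w y - \<chi> w0 y)"] show ?thesis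
      using y by simp
  qed
  have "(\<Sum>w\<in>insert w0 W. \<chi> w e *\<^sub>P F w) - (\<Sum>w\<in>W. F w) \<in> K"
    by (intro pol.subspace_diff[OF K] pol.subspace_sum[OF K] insert.prems one mem)
  also have "(\<Sum>w\<in>insert w0 W. \<chi> w e *\<^sub>P F w) = (\<Sum>w\<in>insert w0 W. F w)"
    by (intro sum.cong refl) (simp add: insert.prems del: insert_iff)
  finally have "F w0 \<in> K" using insert.hyps by simp
  then show ?case using mem insert.prems by auto
qed simp

text \<open>Distinct monomials are distinct characters of the monoid of points under pointwise
  multiplication, so the independence of characters applies with \<open>K = {0}\<close>.\<close>

lemma pol_eqI_ev:
  fixes f g :: "'v pol"
  assumes "\<And>z. ev z f = ev z g"
  shows "f = g"
proof -
  have "lookup (f - g) a = 0" if "a \<in> keys (f - g)" for a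
  proof -
    \<comment> \<open>The coefficients appear as constant polynomials, since the independence lemma
      combines polynomials rather than numbers.\<close>
    have "(single 0 (lookup (f - g) a) :: 'v pol) \<in> {0}"
    proof (rule characters_independent_mod[where \<chi> = "\<lambda>a z. mon z a" and T = UNIV
          and m = "\<lambda>x y v. x v * y v" and e = "\<lambda>_. 1" and W = "keys (f - g)"])
      fix a b :: "'v mono" assume "a \<noteq> b"
      then obtain v where v: "lookup a v \<noteq> lookup b v" by (meson poly_mapping_eqI)
      then have "(2::complex) ^ lookup a v \<noteq> 2 ^ lookup b v"
        by (metis of_nat_eq_iff of_nat_numeral of_nat_power one_less_numeral_iff power_inject_exp
            semiring_norm(76))
      then show "\<exists>x\<in>UNIV. mon x a \<noteq> mon x b" by (metis UNIV_I mon_update_one)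
    next
      fix z :: "'v \<Rightarrow> complex"
      have "(\<Sum>a\<in>keys (f - g). mon z a *\<^sub>P single 0 (lookup (f - g) a) :: 'v pol)
          = single 0 (ev z (f - g))"
        by (rule poly_mapping_eqI)
          (auto simp: lookup_sum lookup_single when_def ev_def mult.commute)
      also have "\<dots> = 0" using assms by simp
      finally show "(\<Sum>a\<in>keys (f - g). mon z a *\<^sub>P single 0 (lookup (f - g) a) :: 'v pol) \<in> {0}"
        by simp
    qed (use that in \<open>auto simp: mon_mult pol.subspace_def\<close>)
    then show ?thesis
      by (metis singletonD lookup_single_eq lookup_zero)
  qed
  then have "f - g = 0" by (metis in_keys_iff poly_mapping_eqI lookup_zero)
  then show ?thesis by simp
qed

section \<open>The differentiation pairing\<close>

text \<open>Induction that peels off one variable at a time, the form in which the Leibniz rule and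
  the adjointness of multiplication and differentiation can be applied.\<close>

lemma pol_induct_Var [case_names const Var add]:
  fixes f :: "'v pol"
  assumes const: "\<And>c. P (single 0 c)" and Var: "\<And>v f. P f \<Longrightarrow> P (Var v * f)"
    and add: "\<And>f g. P f \<Longrightarrow> P g \<Longrightarrow> P (f + g)"
  shows "P f"
proof (induction f rule: pol_induct)
  case (single a c)
  have pow: "P (single (single v n) 1 * f)" if "P f" for v n f
  proof (induction n)
    case (Suc n)
    have "single (single v (Suc n)) 1 * f = Var v * (single (single v n) 1 * f)"
      by (simp add: Var_def mult_single single_add[symmetric] mult.assoc[symmetric])
    with Suc show ?case by (simp add: Var)
  qed (use that in simp)
  have "P (single (\<Sum>v\<in>A. single v (lookup a v)) c)" if "finite A" for A
    using that
  proof (induction A)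
    case (insert v A)
    have "single (\<Sum>v\<in>insert v A. single v (lookup a v)) c
        = single (single v (lookup a v)) 1 * single (\<Sum>v\<in>A. single v (lookup a v)) c"
      using insert.hyps by (simp add: mult_single)
    then show ?case using insert.IH by (simp add: pow)
  qed (simp add: const)
  from this[of "keys a"] show ?case by (simp add: sum_single_keys)
qed (rule add)

lemma lookup_partial:
  "lookup (partial v f) a = of_nat (lookup a v + 1) * lookup f (a + single v 1)"
proof -
  \<comment> \<open>Subtraction of exponents is truncated, so a monomial without \<open>v\<close>
    could also land on \<open>a\<close>; its factor \<open>lookup b v\<close> is 0, and among the
    others only one \<open>b\<close> remains.\<close>
  have *: "b - single v 1 = a \<and> lookup b v \<noteq> 0 \<longleftrightarrow> b = a + single v 1" for b
  proof
    assume "b - single v 1 = a \<and> lookup b v \<noteq> 0"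
    then show "b = a + single v 1"
      by (intro poly_mapping_eqI) (auto simp: lookup_add lookup_minus lookup_single when_def)
  next
    assume "b = a + single v 1"
    then show "b - single v 1 = a \<and> lookup b v \<noteq> 0"
      by (simp add: lookup_add)
  qed
  have "lookup (partial v f) a
      = (\<Sum>b\<in>keys f. of_nat (lookup b v) * lookup f b when b - single v 1 = a)"
    by (simp add: partial_def lookup_sum lookup_single)
  also have "\<dots> = (\<Sum>b\<in>keys f. if b = a + single v 1
      then of_nat (lookup a v + 1) * lookup f (a + single v 1) else 0)"
    by (intro sum.cong refl) (use * in \<open>force simp: when_def lookup_add\<close>)
  also have "\<dots> = of_nat (lookup a v + 1) * lookup f (a + single v 1)"
    by (simp add: in_keys_iff)
  finally show ?thesis .
qed

lemma lookup_partial_power: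
  "lookup ((partial v ^^ n) f) a
    = fact (lookup a v + n) / fact (lookup a v) * lookup f (a + single v n)"
proof (induction n arbitrary: a)
  case (Suc n)
  have "single v (Suc n) = single v 1 + single v n" by (simp add: single_add[symmetric])
  then show ?case
    by (simp add: lookup_partial Suc lookup_add add.assoc field_simps del: of_nat_Suc)
qed simp

text \<open>Replaces the iterated derivatives in the pairing by a factorial weight on coefficients.
  The \<open>fold\<close> is meaningful only because powers of different partial derivatives
  commute, which is the fact \<open>comp\<close>.\<close>

lemma at_zero_partial_mono:
  "at_zero (partial_mono a f) = (\<Prod>v\<in>keys a. fact (lookup a v)) * lookup f a"
proof -
  have comp: "comp_fun_commute (\<lambda>v. partial v ^^ lookup a v)"
  proof
    fix u v
    show "(partial u ^^ lookup a u) \<circ> (partial v ^^ lookup a v)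
        = (partial v ^^ lookup a v) \<circ> (partial u ^^ lookup a u)"
    proof (cases "u = v")
      case False
      then show ?thesis
        by (intro ext poly_mapping_eqI)
          (simp add: lookup_partial_power lookup_add lookup_single add_ac mult_ac)
    qed simp
  qed
  \<comment> \<open>The coefficient at an arbitrary \<open>b\<close> is needed for the induction,
    since each further derivative shifts the monomial; only \<open>b = 0\<close> is used
    afterwards.\<close>
  have "lookup (Finite_Set.fold (\<lambda>v. partial v ^^ lookup a v) f S) b
      = (\<Prod>v\<in>S. fact (lookup b v + lookup a v) / fact (lookup b v))
        * lookup f (b + (\<Sum>v\<in>S. single v (lookup a v)))" if "finite S" for S b
    using that
  proof (induction S arbitrary: b)
    case (insert v S)
    have "(\<Prod>u\<in>S. fact (lookup (b + single v (lookup a v)) u + lookup a u)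
          / fact (lookup (b + single v (lookup a v)) u))
        = (\<Prod>u\<in>S. fact (lookup b u + lookup a u) / fact (lookup b u) :: complex)"
      using insert.hyps by (intro prod.cong) (auto simp: lookup_add lookup_single when_def)
    then show ?case
      using insert by (simp add: comp_fun_commute_on.fold_insert[OF comp[unfolded comp_fun_commute_def']] lookup_partial_power add_ac)
  qed simp
  from this[OF finite_keys, of a 0] show ?thesis
    by (simp add: at_zero_def partial_mono_def sum_single_keys)
qed

text \<open>The multi-index factorial \<open>a!\<close>, which is the squared norm of the monomial
  \<open>a\<close> in the pairing.\<close>

definition mfact :: "'v mono \<Rightarrow> complex" where
  "mfact a = (\<Prod>v\<in>keys a. fact (lookup a v))"

lemma mfact_superset: "finite S \<Longrightarrow> keys a \<subseteq> S \<Longrightarrow> mfact a = (\<Prod>v\<in>S. fact (lookup a v))"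
  unfolding mfact_def by (rule prod.mono_neutral_left) (auto simp: in_keys_iff)

lemma mfact_0 [simp]: "mfact 0 = 1"
  by (simp add: mfact_def)

lemma mfact_add_single: "mfact (single v 1 + a) = of_nat (lookup a v + 1) * mfact a"
proof -
  let ?S = "insert v (keys a)"
  have "keys (single v 1 + a) \<subseteq> ?S" using keys_add[of "single v 1" a] by auto
  then have "mfact (single v 1 + a) = (\<Prod>u\<in>?S. fact (lookup (single v 1 + a) u))"
    by (intro mfact_superset) auto
  also have "\<dots> = (of_nat (lookup a v + 1) * fact (lookup a v))
      * (\<Prod>u\<in>keys a - {v}. fact (lookup a u))"
    by (subst prod.insert_remove) (auto simp: lookup_add lookup_single when_def intro!: prod.cong split: if_splits)
  also have "\<dots> = of_nat (lookup a v + 1) * (\<Prod>u\<in>?S. fact (lookup a u))"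
    by (subst prod.insert_remove) (auto simp: algebra_simps)
  also have "(\<Prod>u\<in>?S. fact (lookup a u)) = mfact a"
    by (rule mfact_superset[symmetric]) auto
  finally show ?thesis .
qed

lemma mfact_eq_of_nat: "mfact a = of_nat (\<Prod>v\<in>keys a. fact (lookup a v))"
  by (simp add: mfact_def)

lemma lookup_conj_pol [simp]: "lookup (conj_pol f) a = cnj (lookup f a)"
  unfolding conj_pol_def by (simp add: map.rep_eq when_def)

lemma pairing_ser_superset:
  assumes "finite S" "keys f \<subseteq> S"
  shows "pairing_ser F f = (\<Sum>a\<in>S. F a * mfact a * cnj (lookup f a))"
proof -
  have "pairing_ser F f = (\<Sum>a\<in>S. F a * at_zero (partial_mono a (conj_pol f)))"
    unfolding pairing_ser_def using assms
    by (intro Sum_any.expand_superset) (auto simp: at_zero_partial_mono in_keys_iff)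
  then show ?thesis by (simp add: at_zero_partial_mono mfact_def mult.assoc)
qed

lemma pairing_ser_eq: "pairing_ser F f = (\<Sum>a\<in>keys f. F a * mfact a * cnj (lookup f a))"
  by (rule pairing_ser_superset) auto

lemma pairing_eq: "pairing f g = (\<Sum>a\<in>keys g. lookup f a * mfact a * cnj (lookup g a))"
  by (simp add: pairing_def pairing_ser_eq)

lemma pairing_0_left [simp]: "pairing 0 g = 0"
  and pairing_add_left: "pairing (f + f') g = pairing f g + pairing f' g"
  and pairing_smul_left: "pairing (c *\<^sub>P f) g = c * pairing f g"
  by (simp_all add: pairing_eq lookup_add algebra_simps sum.distrib sum_distrib_left)

lemma pairing_0_right [simp]: "pairing g 0 = 0"
  by (simp add: pairing_eq)

lemma pairing_add_right: "pairing g (f + f') = pairing g f + pairing g f'"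
proof -
  let ?S = "keys f \<union> keys f'"
  have "keys (f + f') \<subseteq> ?S" by (rule keys_add)
  then show ?thesis
    by (simp add: pairing_def pairing_ser_superset[of ?S] lookup_add algebra_simps sum.distrib)
qed

lemma pairing_smul_right: "pairing g (c *\<^sub>P f) = cnj c * pairing g f"
proof -
  have "keys (c *\<^sub>P f) \<subseteq> keys f" by (auto simp: in_keys_iff)
  then show ?thesis
    by (simp add: pairing_def pairing_ser_superset[of "keys f"] algebra_simps sum_distrib_left)
qed

lemma pairing_sum_left: "pairing (\<Sum>x\<in>A. F x) g = (\<Sum>x\<in>A. pairing (F x) g)"
  by (induction A rule: infinite_finite_induct) (auto simp: pairing_add_left)

lemma pairing_sum_right: "pairing g (\<Sum>x\<in>A. F x) = (\<Sum>x\<in>A. pairing g (F x))"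
  by (induction A rule: infinite_finite_induct) (auto simp: pairing_add_right)

lemma pairing_single_left: "pairing (single a c) g = c * mfact a * cnj (lookup g a)"
proof -
  have "pairing (single a c) g
      = (\<Sum>b\<in>insert a (keys g). lookup (single a c) b * mfact b * cnj (lookup g b))"
    unfolding pairing_def by (rule pairing_ser_superset) auto
  also have "\<dots> = (\<Sum>b\<in>insert a (keys g). if b = a then c * mfact a * cnj (lookup g a) else 0)"
    by (intro sum.cong refl) (auto simp: lookup_single)
  finally show ?thesis by simp
qed

text \<open>Monomials are orthogonal with positive squared norms, so \<open>pairing f f\<close> is a
  sum of nonnegative reals that vanishes only termwise.\<close>

lemma pairing_self_eq_0:
  assumes "pairing f f = 0"
  shows "f = 0"
proof -
  have "pairing f f = of_real (\<Sum>a\<in>keys f.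
      of_nat (\<Prod>v\<in>keys a. fact (lookup a v)) * (cmod (lookup f a))\<^sup>2)"
    unfolding pairing_eq of_real_sum mfact_eq_of_nat
    by (intro sum.cong refl) (simp only: of_real_mult complex_norm_square of_real_of_nat_eq mult_ac)
  then have "(\<Sum>a\<in>keys f. of_nat (\<Prod>v\<in>keys a. fact (lookup a v)) * (cmod (lookup f a))\<^sup>2) = (0::real)"
    unfolding assms by (subst (asm) eq_commute) (simp only: of_real_eq_0_iff)
  then have "\<forall>a\<in>keys f. of_nat (\<Prod>v\<in>keys a. fact (lookup a v)) * (cmod (lookup f a))\<^sup>2 = (0::real)"
    by (subst (asm) sum_nonneg_eq_0_iff) (auto intro!: mult_nonneg_nonneg prod_nonneg)
  then show ?thesis by (intro poly_mapping_eqI) (auto simp: in_keys_iff)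
qed

section \<open>Leibniz rule and adjointness\<close>

lemma partial_add: "partial v (f + g) = partial v f + partial v g"
  and partial_smul: "partial v (c *\<^sub>P f) = c *\<^sub>P partial v f"
  by (rule poly_mapping_eqI, simp add: lookup_partial lookup_add algebra_simps)+

lemma partial_const [simp]: "partial v (single 0 c) = 0"
  by (cases "c = 0") (simp_all add: partial_def)

lemma partial_single: "partial v (single a c) = single (a - single v 1) (of_nat (lookup a v) * c)"
  by (cases "c = 0") (simp_all add: partial_def)

lemma partial_Var_mult:
  "partial v (Var u * f) = (if u = v then f else 0) + Var u * partial v f"
proof (induction f rule: pol_induct)
  case (single a c)
  have 1: "single v 1 + (a - single v 1) = a" if "lookup a v \<noteq> 0"
    using that by (intro poly_mapping_eqI) (auto simp: lookup_add lookup_minus lookup_single when_def)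
  have 2: "single u 1 + a - single v 1 = single u 1 + (a - single v 1)" if "lookup a v \<noteq> 0"
    using that by (intro poly_mapping_eqI) (auto simp: lookup_add lookup_minus lookup_single when_def)
  show ?case
  proof (cases "lookup a v = 0")
    case True
    then show ?thesis
      by (auto simp: Var_def mult_single partial_single lookup_add lookup_single when_def)
  next
    case False
    then show ?thesis using 1 2
      by (auto simp: Var_def mult_single partial_single lookup_add lookup_single when_def
          single_add[symmetric] distrib_right)
  qed
qed (auto simp: partial_add algebra_simps)

lemma partial_mult: "partial v (f * g) = partial v f * g + f * partial v g"
proof (induction f rule: pol_induct_Var)
  case (const c)
  then show ?case by (simp add: partial_smul[unfolded smul_def])
next
  case (Var u f)
  then show ?case
    by (simp add: partial_Var_mult mult.assoc) (simp add: algebra_simps)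
qed (simp add: partial_add algebra_simps)

lemma partial_0 [simp]: "partial v 0 = 0"
  by (simp add: partial_def)

lemma partial_sum: "partial v (\<Sum>x\<in>A. F x) = (\<Sum>x\<in>A. partial v (F x))"
  by (induction A rule: infinite_finite_induct) (auto simp: partial_add)

lemma partial_Var: "partial v (Var u) = (if u = v then 1 else 0)"
  using partial_Var_mult[of v u 1] partial_const[of v 1] by simp

text \<open>Raising the exponent of \<open>v\<close> multiplies the factorial weight by the new
  exponent, which is exactly the factor produced by differentiation. The unitary invariance of the
  pairing rests on this adjointness.\<close>

lemma pairing_Var_mult: "pairing (Var v * f) g = pairing f (partial v g)"
proof (induction f rule: pol_induct)
  case (single a c)
  have "lookup (partial v g) a = of_nat (lookup a v + 1) * lookup g (single v 1 + a)"
    by (simp add: lookup_partial add.commute)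
  then show ?case
    by (simp add: Var_def mult_single pairing_single_left mfact_add_single del: One_nat_def of_nat_add)
qed (simp add: distrib_left pairing_add_left)

section \<open>Unitary matrices and their action on polynomials\<close>

lemma subst_add: "subst \<sigma> (f + g) = subst \<sigma> f + subst \<sigma> g"
  and subst_mult: "subst \<sigma> (f * g) = subst \<sigma> f * subst \<sigma> g"
  and subst_smul: "subst \<sigma> (c *\<^sub>P f) = c *\<^sub>P subst \<sigma> f"
  and subst_const: "subst \<sigma> (single 0 c) = single 0 c"
  and subst_Var: "subst \<sigma> (Var v) = \<sigma> v"
  by (rule pol_eqI_ev; simp)+

lemma subst_0 [simp]: "subst \<sigma> 0 = 0"
  by (simp add: subst_def)

text \<open>The point \<open>Z g\<close>, summed over the nonzero entries of a column as in
  \<open>entry_mult\<close>; that set is finite for \<open>g\<close> in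
  \<open>U(\<infinity>)\<close>.\<close>

definition mmul :: "('r \<times> nat \<Rightarrow> complex) \<Rightarrow> (nat \<Rightarrow> nat \<Rightarrow> complex) \<Rightarrow> 'r \<times> nat \<Rightarrow> complex" where
  "mmul z g = (\<lambda>(\<rho>, t). \<Sum>s | g s t \<noteq> 0. g s t * z (\<rho>, s))"

definition cnj_mat :: "(nat \<Rightarrow> nat \<Rightarrow> complex) \<Rightarrow> nat \<Rightarrow> nat \<Rightarrow> complex" where
  "cnj_mat g = (\<lambda>s t. cnj (g s t))"

definition adj :: "(nat \<Rightarrow> nat \<Rightarrow> complex) \<Rightarrow> nat \<Rightarrow> nat \<Rightarrow> complex" where
  "adj g = (\<lambda>s t. cnj (g t s))"

lemma ev_entry_mult [simp]: "ev z (entry_mult g v) = mmul z g v"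
  by (cases v) (simp add: entry_mult_def mmul_def)

lemma ev_act: "ev z (act g f) = ev (mmul z g) f"
  by (simp add: act_def)

lemma UmatD:
  assumes "g \<in> Umat k"
  shows Umat_outside: "\<And>s t. k \<le> s \<or> k \<le> t \<Longrightarrow> g s t = (if s = t then 1 else 0)"
    and Umat_rows: "\<And>s t. s < k \<Longrightarrow> t < k \<Longrightarrow> (\<Sum>u<k. g s u * cnj (g t u)) = (if s = t then 1 else 0)"
    and Umat_cols: "\<And>s t. s < k \<Longrightarrow> t < k \<Longrightarrow> (\<Sum>u<k. cnj (g u s) * g u t) = (if s = t then 1 else 0)"
  using assms by (auto simp: Umat_def)

lemma Umat_cnj_mat: "g \<in> Umat k \<Longrightarrow> cnj_mat g \<in> Umat k"
proof -
  assume g: "g \<in> Umat k"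
  have "(\<Sum>u<k. cnj (g s u) * g t u) = (if s = t then 1 else 0)" if "s < k" "t < k" for s t
    using Umat_rows[OF g that(2,1)] by (auto simp: mult.commute)
  moreover have "(\<Sum>u<k. g u s * cnj (g u t)) = (if s = t then 1 else 0)" if "s < k" "t < k" for s t
    using Umat_cols[OF g that(2,1)] by (auto simp: mult.commute)
  ultimately show ?thesis
    using Umat_outside[OF g] by (auto simp: Umat_def cnj_mat_def)
qed

lemma Umat_adj: "g \<in> Umat k \<Longrightarrow> adj g \<in> Umat k"
  unfolding Umat_def adj_def by auto

lemma Umat_mono:
  assumes g: "g \<in> Umat k" and "k \<le> K"
  shows "g \<in> Umat K"
proof -
  \<comment> \<open>Two ways to evaluate an inner product in the larger size: within the old block
    the sum stops at \<open>k\<close>, and beyond it one of the two vectors is a unit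
    vector.\<close>
  have *: "(\<Sum>u<K. F u) = (\<Sum>u<k. F u)" if "\<And>u. k \<le> u \<Longrightarrow> F u = 0" for F :: "nat \<Rightarrow> complex"
    by (rule sum.mono_neutral_right) (use assms that in auto)
  have **: "(\<Sum>u<K. F u) = F s" if "\<And>u. u \<noteq> s \<Longrightarrow> F u = 0" "s < K" for F :: "nat \<Rightarrow> complex" and s
    using that by (subst sum.mono_neutral_right[of _ "{s}"]) auto
  have rows: "(\<Sum>u<K. g s u * cnj (g t u)) = (if s = t then 1 else 0)" if "s < K" "t < K" for s t
  proof -
    consider "s < k" "t < k" | "k \<le> s" | "k \<le> t" by linarith
    then show ?thesis
    proof cases
      case 1
      then show ?thesis
        by (subst *) (auto simp: Umat_rows[OF g] Umat_outside[OF g])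
    next
      case 2
      then show ?thesis using that
        by (subst **[of s]) (auto simp: Umat_outside[OF g])
    next
      case 3
      then show ?thesis using that
        by (subst **[of t]) (auto simp: Umat_outside[OF g])
    qed
  qed
  have cols: "(\<Sum>u<K. cnj (g u s) * g u t) = (if s = t then 1 else 0)" if "s < K" "t < K" for s t
  proof -
    consider "s < k" "t < k" | "k \<le> s" | "k \<le> t" by linarith
    then show ?thesis
    proof cases
      case 1
      then show ?thesis
        by (subst *) (auto simp: Umat_cols[OF g] Umat_outside[OF g])
    next
      case 2
      then show ?thesis using that
        by (subst **[of s]) (auto simp: Umat_outside[OF g])
    next
      case 3
      then show ?thesis using that
        by (subst **[of t]) (auto simp: Umat_outside[OF g])
    qed
  qed
  show ?thesis
    using rows cols assms Umat_outside[OF g] by (auto simp: Umat_def)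
qed

lemma Umat_support:
  assumes "g \<in> Umat k" "t < k"
  shows "{s. g s t \<noteq> 0} \<subseteq> {..<k}" "{s. g t s \<noteq> 0} \<subseteq> {..<k}"
  using Umat_outside[OF assms(1)] assms(2) by (auto simp: not_le[symmetric])

lemma mmul_Umat:
  assumes "g \<in> Umat k"
  shows "mmul z g (\<rho>, t) = (if t < k then \<Sum>s<k. g s t * z (\<rho>, s) else z (\<rho>, t))"
proof (cases "t < k")
  case True
  then show ?thesis
    unfolding mmul_def using Umat_support(1)[OF assms True]
    by (auto intro!: sum.mono_neutral_left)
next
  case False
  then have "{s. g s t \<noteq> 0} = {t}" "g t t = 1" using Umat_outside[OF assms] by auto
  with False show ?thesis by (simp add: mmul_def)
qed

lemma entry_mult_Umat:
  assumes "g \<in> Umat k" "t < k"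
  shows "entry_mult g (\<rho>, t) = (\<Sum>s<k. g s t *\<^sub>P Var (\<rho>, s))"
  by (rule pol_eqI_ev) (simp add: mmul_Umat[OF assms(1)] assms(2))

lemma mmul_adj:
  assumes g: "g \<in> Umat k"
  shows "mmul (mmul z g) (adj g) = z"
proof (rule ext, clarify)
  fix \<rho> t
  show "mmul (mmul z g) (adj g) (\<rho>, t) = z (\<rho>, t)"
  proof (cases "t < k")
    case True
    then have "mmul (mmul z g) (adj g) (\<rho>, t) = (\<Sum>s<k. \<Sum>u<k. cnj (g t s) * (g u s * z (\<rho>, u)))"
      by (simp add: mmul_Umat[OF g] mmul_Umat[OF Umat_adj[OF g]]) (simp add: adj_def sum_distrib_left)
    also have "\<dots> = (\<Sum>u<k. z (\<rho>, u) * (\<Sum>s<k. g u s * cnj (g t s)))"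
      by (subst sum.swap) (simp add: sum_distrib_left mult_ac)
    also have "\<dots> = (\<Sum>u<k. if u = t then z (\<rho>, u) else 0)"
      by (intro sum.cong refl) (use True in \<open>auto simp: Umat_rows[OF g]\<close>)
    finally show ?thesis using True by simp
  next
    case False
    then show ?thesis by (simp add: mmul_Umat[OF g] mmul_Umat[OF Umat_adj[OF g]])
  qed
qed

lemma adj_adj [simp]: "adj (adj g) = g"
  by (simp add: adj_def)

lemma cnj_mat_cnj_mat [simp]: "cnj_mat (cnj_mat g) = g"
  by (simp add: cnj_mat_def)

lemma act_act_adj: "g \<in> Umat k \<Longrightarrow> act (adj g) (act g f) = f" "g \<in> Umat k \<Longrightarrow> act g (act (adj g) f) = f"
proof -
  show "act g (act (adj g) f) = f" if "g \<in> Umat k" for g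
    by (rule pol_eqI_ev) (simp add: ev_act mmul_adj[OF that])
  from this[OF Umat_adj] show "g \<in> Umat k \<Longrightarrow> act (adj g) (act g f) = f" by simp
qed

section \<open>The inverse in \<open>U_inf\<close>\<close>

lemma mult_U_inf:
  assumes "g \<in> Umat k" "s < k"
  shows "(g \<otimes>\<^bsub>U_inf\<^esub> h) s t = (\<Sum>u<k. g s u * h u t)"
  unfolding U_inf_def using Umat_support(2)[OF assms] by (auto intro!: sum.mono_neutral_left)

lemma mult_U_inf_outside:
  assumes "g \<in> Umat k" "k \<le> s"
  shows "(g \<otimes>\<^bsub>U_inf\<^esub> h) s t = h s t"
proof -
  have "{u. g s u \<noteq> 0} = {s}" "g s s = 1" using Umat_outside[OF assms(1)] assms(2) by auto
  then show ?thesis by (simp add: U_inf_def)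
qed

lemma one_U_inf: "\<one>\<^bsub>U_inf\<^esub> s t = (if s = t then 1 else 0)"
  by (simp add: U_inf_def)

lemma U_inf_right_inverse:
  assumes g: "g \<in> Umat k"
  shows "g \<otimes>\<^bsub>U_inf\<^esub> adj g = \<one>\<^bsub>U_inf\<^esub>"
proof (intro ext)
  fix s t
  show "(g \<otimes>\<^bsub>U_inf\<^esub> adj g) s t = \<one>\<^bsub>U_inf\<^esub> s t"
  proof (cases "s < k")
    case True
    show ?thesis
    proof (cases "t < k")
      case True
      then show ?thesis
        using \<open>s < k\<close> by (simp add: mult_U_inf[OF g] adj_def Umat_rows[OF g] one_U_inf)
    next
      case False
      then have "cnj (g t u) = 0" if "u < k" for u
        using Umat_outside[OF g, of t u] that by auto
      then show ?thesis using \<open>s < k\<close> False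
        by (auto simp: mult_U_inf[OF g] adj_def one_U_inf)
    qed
  next
    case False
    then show ?thesis
      using Umat_outside[OF g, of t s]
      by (auto simp: mult_U_inf_outside[OF g] adj_def one_U_inf)
  qed
qed

text \<open>The inverse is a definite description over the whole carrier, so uniqueness has to be
  shown against any \<open>y\<close> in any \<open>U(l)\<close>. In a common \<open>U(K)\<close> it
  is the usual computation \<open>y = y (g adj g) = (y g) adj g = adj g\<close>.\<close>

lemma inv_U_inf:
  assumes g: "g \<in> Umat k"
  shows "inv\<^bsub>U_inf\<^esub> g = adj g"
  unfolding m_inv_def
proof (rule the_equality)
  show "adj g \<in> carrier U_inf \<and> g \<otimes>\<^bsub>U_inf\<^esub> adj g = \<one>\<^bsub>U_inf\<^esub> \<and> adj g \<otimes>\<^bsub>U_inf\<^esub> g = \<one>\<^bsub>U_inf\<^esub>"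
    using U_inf_right_inverse[OF g] U_inf_right_inverse[OF Umat_adj[OF g]] Umat_adj[OF g]
    by (auto simp: U_inf_def)
next
  fix y assume y: "y \<in> carrier U_inf \<and> g \<otimes>\<^bsub>U_inf\<^esub> y = \<one>\<^bsub>U_inf\<^esub> \<and> y \<otimes>\<^bsub>U_inf\<^esub> g = \<one>\<^bsub>U_inf\<^esub>"
  then obtain l where "y \<in> Umat l" by (auto simp: U_inf_def)
  define K where "K = max k l"
  have yK: "y \<in> Umat K" and gK: "g \<in> Umat K"
    using Umat_mono \<open>y \<in> Umat l\<close> g by (auto simp: K_def)
  show "y = adj g"
  proof (intro ext)
    fix s t
    show "y s t = adj g s t"
    proof (cases "s < K \<and> t < K")
      case True
      have yg: "(\<Sum>u<K. y s u * g u v) = (if s = v then 1 else 0)" for v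
        using mult_U_inf[OF yK, of s g v] y True by (simp add: one_U_inf)
      have "y s t = (\<Sum>u<K. y s u * (if u = t then 1 else 0))"
        using True by (simp add: if_distrib[of "(*) _"] cong: if_cong)
      also have "\<dots> = (\<Sum>u<K. y s u * (\<Sum>v<K. g u v * cnj (g t v)))"
        using True by (intro sum.cong refl) (simp add: Umat_rows[OF gK])
      also have "\<dots> = (\<Sum>u<K. \<Sum>v<K. y s u * g u v * cnj (g t v))"
        by (simp add: sum_distrib_left mult_ac)
      also have "\<dots> = (\<Sum>v<K. \<Sum>u<K. y s u * g u v * cnj (g t v))"
        by (rule sum.swap)
      also have "\<dots> = (\<Sum>v<K. (\<Sum>u<K. y s u * g u v) * cnj (g t v))"
        by (simp add: sum_distrib_right)
      also have "\<dots> = (\<Sum>v<K. if v = s then cnj (g t v) else 0)"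
        by (intro sum.cong refl) (auto simp: yg)
      also have "\<dots> = adj g s t" using True by (simp add: adj_def)
      finally show ?thesis .
    next
      case False
      then have "y s t = (if s = t then 1 else 0)" "g t s = (if t = s then 1 else 0)"
        using Umat_outside[OF yK, of s t] Umat_outside[OF gK, of t s] by auto
      then show ?thesis by (simp add: adj_def)
    qed
  qed
qed

text \<open>For a unitary matrix the inverse transpose is the entrywise conjugate. Hence the dual
  action is again a unitary substitution, and every \<open>act g\<close> is the dual action of a
  unitary matrix.\<close>

lemma contra_Umat: "g \<in> Umat k \<Longrightarrow> contra g = cnj_mat g"
  by (simp add: contra_def inv_U_inf adj_def cnj_mat_def)

section \<open>The chain rule and the unitarity of the action\<close>

lemma act_add: "act g (f + f') = act g f + act g f'"
  and act_smul: "act g (c *\<^sub>P f) = c *\<^sub>P act g f"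
  and act_0 [simp]: "act g 0 = 0"
  and act_mult: "act g (f * f') = act g f * act g f'"
  and act_Var: "act g (Var v) = entry_mult g v"
  and act_const: "act g (single 0 c) = single 0 c"
  by (simp_all add: act_def subst_add subst_smul subst_mult subst_Var subst_const)

lemma smul_mult_left: "(c *\<^sub>P f) * g = c *\<^sub>P (f * g)"
  and smul_mult_right: "f * (c *\<^sub>P g) = c *\<^sub>P (f * g)"
  by (simp_all add: smul_def mult_ac)

text \<open>The chain rule for \<open>Z \<mapsto> Z h\<close>. Peeling off variables reduces it to
  the Leibniz rule and the derivative of a single entry of \<open>Z h\<close>.\<close>

lemma partial_act:
  fixes b :: "('r \<times> nat) pol"
  assumes h: "h \<in> Umat k" and s: "s < k"
  shows "partial (\<rho>, s) (act h b) = (\<Sum>u<k. h s u *\<^sub>P act h (partial (\<rho>, u) b))"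
proof (induction b rule: pol_induct_Var)
  case (const c)
  then show ?case by (simp add: act_const)
next
  case (Var v b)
  obtain \<sigma> t where v: "v = (\<sigma>, t)" by (cases v)
  \<comment> \<open>A variable in a column beyond \<open>k\<close> is fixed by \<open>h\<close>, and
    its derivative in column \<open>s\<close> is 0, as is \<open>h s t\<close>; the formula thus
    holds in every column.\<close>
  have entry: "partial (\<rho>, s) (entry_mult h (\<sigma>, t)) = (if \<sigma> = \<rho> then single 0 (h s t) else 0)"
  proof (cases "t < k")
    case True
    then show ?thesis using s
      by (auto simp: entry_mult_Umat[OF h] partial_sum partial_smul partial_Var if_distrib[of "(*\<^sub>P) _"]
          cong: if_cong) (simp add: smul_def)
  next
    case False
    then have "entry_mult h (\<sigma>, t) = Var (\<sigma>, t)" "h s t = 0"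
      using s Umat_outside[OF h, of s t] by (auto intro!: pol_eqI_ev simp: mmul_Umat[OF h])
    then show ?thesis using s False by (auto simp: partial_Var)
  qed
  have sum: "(\<Sum>u<k. h s u *\<^sub>P (if v = (\<rho>, u) then act h b else 0))
      = (if \<sigma> = \<rho> then h s t *\<^sub>P act h b else 0)"
  proof (cases "t < k")
    case True
    then show ?thesis
      by (auto simp: v if_distrib[of "(*\<^sub>P) _"] cong: if_cong)
  next
    case False
    then have "h s t = 0" using s Umat_outside[OF h, of s t] by auto
    with False show ?thesis by (auto simp: v intro!: sum.neutral)
  qed
  have "partial (\<rho>, s) (act h (Var v * b))
      = partial (\<rho>, s) (entry_mult h v) * act h b + entry_mult h v * partial (\<rho>, s) (act h b)"
    by (simp add: act_mult act_Var partial_mult)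
  also have "\<dots> = (\<Sum>u<k. h s u *\<^sub>P (if v = (\<rho>, u) then act h b else 0))
      + (\<Sum>u<k. h s u *\<^sub>P (entry_mult h v * act h (partial (\<rho>, u) b)))"
  proof (intro arg_cong2[where f = "(+)"])
    show "partial (\<rho>, s) (entry_mult h v) * act h b
        = (\<Sum>u<k. h s u *\<^sub>P (if v = (\<rho>, u) then act h b else 0))"
      unfolding sum using entry by (auto simp: v smul_def)
    show "entry_mult h v * partial (\<rho>, s) (act h b)
        = (\<Sum>u<k. h s u *\<^sub>P (entry_mult h v * act h (partial (\<rho>, u) b)))"
      by (simp add: Var.IH sum_distrib_left smul_mult_right)
  qed
  also have "\<dots> = (\<Sum>u<k. h s u *\<^sub>P act h (partial (\<rho>, u) (Var v * b)))"
    unfolding sum.distrib[symmetric]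
    by (intro sum.cong refl)
      (simp add: partial_Var_mult act_add act_mult act_Var pol.scale_right_distrib)
  finally show ?case .
next
  case (add f g)
  then show ?case
    by (simp add: act_add partial_add pol.scale_right_distrib sum.distrib)
qed

lemma lookup_0_eq_ev:
  fixes g :: "'v pol"
  shows "lookup g 0 = ev (\<lambda>_. 0) g"
proof -
  have "mon (\<lambda>_. 0) a = (if a = 0 then 1 else 0)" for a :: "'v mono"
    by (auto simp: mon_def in_keys_iff) (metis lookup_zero neq0_conv poly_mapping_eqI)
  then show ?thesis
    by (simp add: ev_def if_distrib[of "(*) _"] in_keys_iff cong: if_cong)
qed

lemma lookup_act_0:
  fixes f :: "('r \<times> nat) pol"
  shows "lookup (act h f) 0 = lookup f 0"
proof -
  have "mmul (\<lambda>_. 0) h = (\<lambda>_ :: 'r \<times> nat. 0)" by (auto simp: mmul_def)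
  then show ?thesis by (simp add: ev_act lookup_0_eq_ev)
qed

text \<open>A variable split off from \<open>a\<close> turns into a derivative of
  \<open>act h b\<close>. The chain rule brings in a second factor from \<open>h\<close>, and the
  orthonormality of the columns of \<open>h\<close> collapses the double sum.\<close>

lemma pairing_act_act:
  assumes "h \<in> Umat k"
  shows "pairing (act h a) (act h b) = pairing a b"
proof (induction a arbitrary: b rule: pol_induct_Var)
  case (const c)
  then show ?case
    by (simp add: act_const pairing_single_left lookup_act_0)
next
  case (Var v a)
  obtain \<rho> t where v: "v = (\<rho>, t)" by (cases v)
  \<comment> \<open>The variable may lie beyond column \<open>k\<close>, so \<open>h\<close> is
    regarded as an element of a larger unitary group.\<close>
  define K where "K = max k (Suc t)"
  have h: "h \<in> Umat K" and t: "t < K" using Umat_mono[OF assms] by (auto simp: K_def)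
  have "pairing (act h (Var v * a)) (act h b)
      = (\<Sum>s<K. h s t * pairing (act h a) (partial (\<rho>, s) (act h b)))"
    by (simp add: act_mult act_Var v entry_mult_Umat[OF h t] sum_distrib_right pairing_sum_left
        smul_mult_left pairing_smul_left pairing_Var_mult)
  also have "\<dots> = (\<Sum>s<K. \<Sum>u<K. h s t * cnj (h s u) * pairing a (partial (\<rho>, u) b))"
    by (intro sum.cong refl)
      (simp add: partial_act[OF h] pairing_sum_right pairing_smul_right Var.IH sum_distrib_left mult_ac)
  also have "\<dots> = (\<Sum>u<K. \<Sum>s<K. h s t * cnj (h s u) * pairing a (partial (\<rho>, u) b))"
    by (rule sum.swap)
  also have "\<dots> = (\<Sum>u<K. (\<Sum>s<K. cnj (h s u) * h s t) * pairing a (partial (\<rho>, u) b))"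
    by (simp add: sum_distrib_left sum_distrib_right mult_ac)
  also have "\<dots> = (\<Sum>u<K. if u = t then pairing a (partial (\<rho>, u) b) else 0)"
    using t by (intro sum.cong refl) (auto simp: Umat_cols[OF h])
  also have "\<dots> = pairing (Var v * a) b"
    using t by (simp add: pairing_Var_mult v)
  finally show ?case .
qed (simp add: act_add pairing_add_left)

section \<open>The modules\<close>

text \<open>Rescaling the variables is diagonal on monomials. The hypothesis is stated for values,
  so it covers torus elements, row scalings and the doubling of a single variable alike.\<close>

lemma lookup_scale:
  assumes "\<And>z. ev z p = ev (\<lambda>v. y v * z v) f"
  shows "lookup p a = mon y a * lookup f a"
proof -
  have "p = (\<Sum>a\<in>keys f. single a (mon y a * lookup f a))"
    by (rule pol_eqI_ev) (simp add: assms ev_def[where f = f] mon_mult mult_ac)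
  then have "lookup p a = (\<Sum>b\<in>keys f. if b = a then mon y b * lookup f b else 0)"
    by (simp add: lookup_sum lookup_single when_def)
  then show ?thesis by (simp add: in_keys_iff)
qed

text \<open>A criterion by values, convenient after a substitution. Conversely, doubling a variable
  outside \<open>S\<close> changes no value, yet it would multiply some nonzero coefficient by a
  proper power of 2.\<close>

lemma vars_subset_iff:
  "vars f \<subseteq> S \<longleftrightarrow> (\<forall>z z'. (\<forall>v\<in>S. z v = z' v) \<longrightarrow> ev z f = ev z' f)"
proof
  assume "vars f \<subseteq> S"
  then show "\<forall>z z'. (\<forall>v\<in>S. z v = z' v) \<longrightarrow> ev z f = ev z' f"
    by (auto intro!: ev_cong)
next
  assume R: "\<forall>z z'. (\<forall>v\<in>S. z v = z' v) \<longrightarrow> ev z f = ev z' f"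
  show "vars f \<subseteq> S"
  proof (rule subsetI, rule ccontr)
    fix v assume v: "v \<in> vars f" "v \<notin> S"
    then obtain a where a: "lookup f a \<noteq> 0" "lookup a v \<noteq> 0"
      by (auto simp: vars_def in_keys_iff)
    have "lookup f a = mon ((\<lambda>_. 1)(v := 2)) a * lookup f a"
      by (rule lookup_scale) (use R v in auto)
    then have "(2::complex) ^ lookup a v = 1" using a by (simp add: mon_update_one)
    then have "(2::nat) ^ lookup a v = 1"
      by (metis of_nat_1 of_nat_eq_iff of_nat_numeral of_nat_power)
    then show False using a by simp
  qed
qed

definition lmul :: "nat \<Rightarrow> (nat \<Rightarrow> nat \<Rightarrow> complex) \<Rightarrow> (nat \<times> nat \<Rightarrow> complex) \<Rightarrow> nat \<times> nat \<Rightarrow> complex" where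
  "lmul q b z = (\<lambda>(\<alpha>, t). \<Sum>\<beta><q. b \<alpha> \<beta> * z (\<beta>, t))"

lemma Vmod_iff:
  "f \<in> Vmod m k \<longleftrightarrow> vars f \<subseteq> {..<length m} \<times> {..<k} \<and>
     (\<forall>b. inv_lower_triangular (length m) b \<longrightarrow>
        (\<forall>z. ev (lmul (length m) b z) f = (\<Prod>\<alpha><length m. b \<alpha> \<alpha> ^ (m ! \<alpha>)) * ev z f))"
proof -
  have "subst (\<lambda>(\<alpha>, t). \<Sum>\<beta><length m. b \<alpha> \<beta> *\<^sub>P Var (\<beta>, t)) f
          = (\<Prod>\<alpha><length m. b \<alpha> \<alpha> ^ (m ! \<alpha>)) *\<^sub>P f \<longleftrightarrow>
      (\<forall>z. ev (lmul (length m) b z) f = (\<Prod>\<alpha><length m. b \<alpha> \<alpha> ^ (m ! \<alpha>)) * ev z f)"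
    (is "?l = ?r \<longleftrightarrow> _") for b
  proof -
    have "(?l = ?r) \<longleftrightarrow> (\<forall>z. ev z ?l = ev z ?r)"
      by (auto intro: pol_eqI_ev simp del: ev_subst ev_smul)
    moreover have "ev z ?l = ev (lmul (length m) b z) f" for z
      by (simp add: lmul_def case_prod_unfold)
    ultimately show ?thesis by simp
  qed
  then show ?thesis by (simp add: Vmod_def)
qed

lemma vars_add: "vars (f + g) \<subseteq> vars f \<union> vars g"
  using keys_add[of f g] by (auto simp: vars_def)

lemma vars_smul: "vars (c *\<^sub>P f) \<subseteq> vars f"
  by (auto simp: vars_def in_keys_iff)

lemma subspace_Vmod: "pol.subspace (Vmod m k)"
proof (rule pol.subspaceI)
  show "x + y \<in> Vmod m k" if "x \<in> Vmod m k" "y \<in> Vmod m k" for x y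
    using that vars_add[of x y] by (auto simp: Vmod_iff distrib_left)
  show "c *\<^sub>P x \<in> Vmod m k" if "x \<in> Vmod m k" for c x
    using that vars_smul[of c x] by (auto simp: Vmod_iff)
  show "0 \<in> Vmod m k" by (auto simp: Vmod_iff vars_def)
qed

lemma Vmod_mono: "k \<le> K \<Longrightarrow> Vmod m k \<subseteq> Vmod m K"
  unfolding Vmod_def by fastforce

lemma subspace_V_inf: "pol.subspace (V_inf m)"
proof (rule pol.subspaceI)
  show "0 \<in> V_inf m"
    using pol.subspace_0[OF subspace_Vmod] by (auto simp: V_inf_def)
next
  fix x y assume "x \<in> V_inf m" "y \<in> V_inf m"
  then obtain k l where "x \<in> Vmod m k" "y \<in> Vmod m l" by (auto simp: V_inf_def)
  then have "x \<in> Vmod m (max k l)" "y \<in> Vmod m (max k l)"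
    using Vmod_mono max.cobounded1 max.cobounded2 by blast+
  then have "x + y \<in> Vmod m (max k l)" by (rule pol.subspace_add[OF subspace_Vmod])
  then show "x + y \<in> V_inf m" by (auto simp: V_inf_def)
next
  fix c x assume "x \<in> V_inf m"
  then show "c *\<^sub>P x \<in> V_inf m"
    using pol.subspace_scale[OF subspace_Vmod] unfolding V_inf_def by blast
qed

text \<open>Left and right multiplication commute, so the transformation law on the left survives
  the action on the right; this keeps \<open>Vmod\<close> stable under \<open>act\<close>.\<close>

lemma mmul_lmul: "mmul (lmul q b z) g = lmul q b (mmul z g)"
proof (rule ext, clarify)
  fix \<alpha> t
  have "mmul (lmul q b z) g (\<alpha>, t) = (\<Sum>s | g s t \<noteq> 0. \<Sum>\<beta><q. g s t * (b \<alpha> \<beta> * z (\<beta>, s)))"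
    by (simp add: mmul_def lmul_def sum_distrib_left)
  also have "\<dots> = (\<Sum>\<beta><q. \<Sum>s | g s t \<noteq> 0. g s t * (b \<alpha> \<beta> * z (\<beta>, s)))"
    by (rule sum.swap)
  also have "\<dots> = lmul q b (mmul z g) (\<alpha>, t)"
    by (simp add: mmul_def lmul_def sum_distrib_left mult_ac)
  finally show "mmul (lmul q b z) g (\<alpha>, t) = lmul q b (mmul z g) (\<alpha>, t)" .
qed

lemma act_Vmod:
  assumes "f \<in> Vmod m k" "g \<in> Umat k"
  shows "act g f \<in> Vmod m k"
  unfolding Vmod_iff
proof (intro conjI allI impI)
  show "vars (act g f) \<subseteq> {..<length m} \<times> {..<k}"
    unfolding vars_subset_iff
  proof (intro allI impI)
    fix z z' :: "nat \<times> nat \<Rightarrow> complex" assume eq: "\<forall>v\<in>{..<length m} \<times> {..<k}. z v = z' v"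
    have "mmul z g v = mmul z' g v" if "v \<in> {..<length m} \<times> {..<k}" for v
      using that eq by (cases v) (auto simp: mmul_Umat[OF assms(2)])
    moreover have "vars f \<subseteq> {..<length m} \<times> {..<k}" using assms(1) by (simp add: Vmod_iff)
    ultimately show "ev z (act g f) = ev z' (act g f)"
      by (auto simp: ev_act intro!: ev_cong)
  qed
qed (use assms(1) in \<open>auto simp: ev_act mmul_lmul Vmod_iff\<close>)

section \<open>Tensor products and the partial pairing\<close>

text \<open>The push-forward of exponents. An injective \<open>h\<close> relabels the variables,
  while \<open>fst\<close> and \<open>snd\<close> give the row degrees and the column degrees of a
  monomial in matrix entries.\<close>

definition mono_image :: "('v \<Rightarrow> 'u) \<Rightarrow> 'v mono \<Rightarrow> 'u mono" where
  "mono_image h a = (\<Sum>v\<in>keys a. single (h v) (lookup a v))"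

lemma mon_sum: "mon x (\<Sum>v\<in>A. F v) = (\<Prod>v\<in>A. mon x (F v))"
  by (induction A rule: infinite_finite_induct) (auto simp: mon_add)

lemma mon_mono_image: "mon x (mono_image h a) = mon (\<lambda>v. x (h v)) a"
  by (simp add: mono_image_def mon_sum) (simp add: mon_def)

lemma lookup_mono_image:
  "lookup (mono_image h a) u = (\<Sum>v\<in>keys a. if h v = u then lookup a v else 0)"
  by (simp add: mono_image_def lookup_sum lookup_single when_def)

lemma lookup_mono_image_inj: "inj h \<Longrightarrow> lookup (mono_image h a) (h v) = lookup a v"
  by (simp add: lookup_mono_image inj_eq in_keys_iff)

lemma lookup_mono_image_notin: "u \<notin> range h \<Longrightarrow> lookup (mono_image h a) u = 0"
  by (auto simp: lookup_mono_image intro!: sum.neutral)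

lemma rename_single: "rename h (single a c) = single (mono_image h a) c"
  by (rule pol_eqI_ev) (simp add: mon_mono_image)

lemma inj_z_tag: "inj z_tag" and inj_w_tag: "inj w_tag"
  by (auto simp: inj_on_def z_tag_def w_tag_def)

lemma tag_cases: obtains u where "v = z_tag u" | u where "v = w_tag u"
proof (cases v)
  case (Pair \<rho> t)
  then show ?thesis
    using that(1)[of "(projl \<rho>, t)"] that(2)[of "(projr \<rho>, t)"]
    by (cases \<rho>) (auto simp: z_tag_def w_tag_def)
qed

lemma tag_neq [simp]: "z_tag u \<noteq> w_tag v" "w_tag v \<noteq> z_tag u"
  by (auto simp: z_tag_def w_tag_def split: prod.splits)

text \<open>The inverse of splitting a monomial into its parts in \<open>Z\<close> and in
  \<open>w\<close>, so that monomials in both sets of variables are indexed by pairs.\<close>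

definition zw :: "zvar mono \<Rightarrow> (nat \<times> nat) mono \<Rightarrow> zwvar mono" where
  "zw a b = mono_image z_tag a + mono_image w_tag b"

lemma lookup_zw [simp]:
  "lookup (zw a b) (z_tag u) = lookup a u"
  "lookup (zw a b) (w_tag v) = lookup b v"
  by (simp_all add: zw_def lookup_add lookup_mono_image_inj inj_z_tag inj_w_tag
      lookup_mono_image_notin image_iff)

abbreviation zpart :: "zwvar mono \<Rightarrow> zvar mono" where
  "zpart \<equiv> Poly_Mapping.map_key z_tag"

abbreviation wpart :: "zwvar mono \<Rightarrow> (nat \<times> nat) mono" where
  "wpart \<equiv> Poly_Mapping.map_key w_tag"

lemma lookup_zpart [simp]: "lookup (zpart c) u = lookup c (z_tag u)"
  and lookup_wpart [simp]: "lookup (wpart c) v = lookup c (w_tag v)"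
  by (simp_all add: map_key.rep_eq inj_z_tag inj_w_tag)

lemma zpart_zw [simp]: "zpart (zw a b) = a" and wpart_zw [simp]: "wpart (zw a b) = b"
  by (simp_all add: poly_mapping_eqI)

lemma zw_parts [simp]: "zw (zpart c) (wpart c) = c"
proof (rule poly_mapping_eqI)
  show "lookup (zw (zpart c) (wpart c)) v = lookup c v" for v
    by (cases v rule: tag_cases) simp_all
qed

lemma zw_eq_iff [simp]: "zw a b = zw a' b' \<longleftrightarrow> a = a' \<and> b = b'"
  by (metis zpart_zw wpart_zw)

text \<open>The two parts have disjoint variables. This multiplicativity makes the pairing of
  product tensors factor, and makes contracting first \<open>w\<close> and then \<open>Z\<close> the
  same as contracting both at once.\<close>

lemma mfact_zw: "mfact (zw a b) = mfact a * mfact b"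
proof -
  have k: "keys (zw a b) \<subseteq> z_tag ` keys a \<union> w_tag ` keys b"
  proof
    fix v assume "v \<in> keys (zw a b)"
    then show "v \<in> z_tag ` keys a \<union> w_tag ` keys b"
      by (cases v rule: tag_cases) (auto simp: in_keys_iff)
  qed
  have "mfact (zw a b) = (\<Prod>v\<in>z_tag ` keys a \<union> w_tag ` keys b. fact (lookup (zw a b) v))"
    by (rule mfact_superset) (use k in auto)
  also have "\<dots> = (\<Prod>v\<in>z_tag ` keys a. fact (lookup (zw a b) v))
      * (\<Prod>v\<in>w_tag ` keys b. fact (lookup (zw a b) v))"
    by (rule prod.union_disjoint) auto
  also have "\<dots> = mfact a * mfact b"
    by (simp add: prod.reindex inj_on_subset[OF inj_z_tag] inj_on_subset[OF inj_w_tag] mfact_def)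
  finally show ?thesis .
qed

lemma ev_tensor_zw: "ev z (tensor_zw u f) = ev (\<lambda>v. z (z_tag v)) u * ev (\<lambda>v. z (w_tag v)) f"
  by (simp add: tensor_zw_def)

lemma tensor_zw_add_left: "tensor_zw (u + u') f = tensor_zw u f + tensor_zw u' f"
  and tensor_zw_add_right: "tensor_zw u (f + f') = tensor_zw u f + tensor_zw u f'"
  by (rule pol_eqI_ev; simp add: ev_tensor_zw algebra_simps)+

lemma tensor_zw_single: "tensor_zw (single a c) (single b d) = single (zw a b) (c * d)"
  by (simp add: tensor_zw_def rename_single mult_single zw_def)

text \<open>Every monomial is a product tensor, so an identity additive in \<open>t\<close> only has
  to be checked on product tensors.\<close>

lemma single_as_tensor: "single c d = tensor_zw (single (zpart c) d) (single (wpart c) 1)"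
  by (simp add: tensor_zw_single)

lemma lookup_tensor_zw: "lookup (tensor_zw u f) (zw a b) = lookup u a * lookup f b"
proof (induction u rule: pol_induct)
  case (single a' c)
  show ?case
    by (induction f rule: pol_induct)
      (auto simp: tensor_zw_single tensor_zw_add_right lookup_add lookup_single when_def distrib_left)
qed (simp add: tensor_zw_add_left lookup_add distrib_right)

text \<open>The coefficient of the monomial \<open>a\<close> in \<open>Z\<close>, as a polynomial in
  \<open>w\<close>.\<close>

definition zcoef :: "zvar mono \<Rightarrow> zwvar pol \<Rightarrow> (nat \<times> nat) pol" where
  "zcoef a t = Poly_Mapping.map_key (zw a) t"

lemma lookup_zcoef [simp]: "lookup (zcoef a t) b = lookup t (zw a b)"
  by (simp add: zcoef_def map_key.rep_eq inj_def)

lemma zcoef_0 [simp]: "zcoef a 0 = 0"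
  and zcoef_add: "zcoef a (t + t') = zcoef a t + zcoef a t'"
  and zcoef_smul: "zcoef a (c *\<^sub>P t) = c *\<^sub>P zcoef a t"
  and zcoef_tensor: "zcoef a (tensor_zw u f) = lookup u a *\<^sub>P f"
  by (rule poly_mapping_eqI; simp add: lookup_add lookup_tensor_zw)+

lemma pairing_w_superset:
  assumes "finite S" "keys t \<subseteq> S"
  shows "pairing_w (lookup t) f
    = (\<Sum>c\<in>S. single (zpart c) (lookup t c * mfact (wpart c) * cnj (lookup f (wpart c))))"
proof -
  let ?F = "\<lambda>c. single (zpart c) (lookup t c * at_zero (partial_mono (wpart c) (conj_pol f)))"
  have "c \<in> S" if "?F c \<noteq> 0" for c
  proof -
    have "lookup t c \<noteq> 0" using that by auto
    then show ?thesis using assms(2) by (auto simp: in_keys_iff)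
  qed
  then have "pairing_w (lookup t) f = sum ?F S"
    unfolding pairing_w_def by (intro Sum_any.expand_superset assms(1)) blast
  then show ?thesis by (simp add: at_zero_partial_mono mfact_def mult.assoc)
qed

text \<open>The contraction works coefficientwise in \<open>Z\<close>. Hence its kernel consists of
  the vectors orthogonal to all \<open>zcoef a t\<close>, which links kernel and orthogonal
  complement in the injectivity proof.\<close>

lemma lookup_pairing_w: "lookup (pairing_w (lookup t) f) a = pairing (zcoef a t) f"
proof (induction t rule: pol_induct)
  case (single c d)
  have 1: "pairing_w (lookup (single c d)) f
      = single (zpart c) (d * mfact (wpart c) * cnj (lookup f (wpart c)))"
    by (subst pairing_w_superset[of "{c}"]) auto
  have 2: "zcoef a (single c d) = (if a = zpart c then single (wpart c) d else 0)"
    by (subst single_as_tensor)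
      (auto simp: zcoef_tensor lookup_single when_def smul_def mult_single)
  show ?case unfolding 1 2 by (auto simp: pairing_single_left lookup_single)
next
  case (add t t')
  let ?S = "keys t \<union> keys t'"
  have "keys (t + t') \<subseteq> ?S" by (rule keys_add)
  then have eq: "pairing_w (lookup (t + t')) f = pairing_w (lookup t) f + pairing_w (lookup t') f"
    by (simp add: pairing_w_superset[of ?S] lookup_add algebra_simps single_add sum.distrib)
  show ?case unfolding eq by (simp add: add lookup_add zcoef_add pairing_add_left)
qed

lemma pairing_w_add_left: "pairing_w (lookup (t + t')) f = pairing_w (lookup t) f + pairing_w (lookup t') f"
  and pairing_w_smul_left: "pairing_w (lookup (c *\<^sub>P t)) f = c *\<^sub>P pairing_w (lookup t) f"
  and pairing_w_0_left: "pairing_w (lookup 0) f = 0"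
  and pairing_w_add: "pairing_w (lookup t) (f + f') = pairing_w (lookup t) f + pairing_w (lookup t) f'"
  and pairing_w_smul: "pairing_w (lookup t) (c *\<^sub>P f) = cnj c *\<^sub>P pairing_w (lookup t) f"
  and pairing_w_0: "pairing_w (lookup t) 0 = 0"
  and pairing_w_tensor: "pairing_w (lookup (tensor_zw u f')) f = pairing f' f *\<^sub>P u"
  by (rule poly_mapping_eqI; unfold lookup_pairing_w; simp add: lookup_pairing_w lookup_add zcoef_add zcoef_smul zcoef_tensor
      pairing_add_left pairing_smul_left pairing_add_right pairing_smul_right)+

lemma pairing_pairing_w: "pairing (pairing_w (lookup t) f) u = pairing t (tensor_zw u f)"
proof (induction t rule: pol_induct)
  case (single c d)
  have "pairing (pairing_w (lookup (single c d)) f) u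
      = pairing (single (wpart c) 1) f * pairing (single (zpart c) d) u"
    by (subst single_as_tensor) (simp add: pairing_w_tensor pairing_smul_left)
  also have "\<dots> = pairing (single (zw (zpart c) (wpart c)) d) (tensor_zw u f)"
    by (simp only: pairing_single_left mfact_zw lookup_tensor_zw) (simp add: mult_ac)
  finally show ?case by simp
qed (simp add: pairing_w_add_left pairing_add_left)

lemma ev_act_zw:
  "ev z (act_zw g t) = ev (\<lambda>(\<rho>, s). case \<rho> of Inl _ \<Rightarrow> mmul z g (\<rho>, s)
      | Inr _ \<Rightarrow> mmul z (contra g) (\<rho>, s)) t"
  unfolding act_zw_def ev_subst
  by (intro arg_cong[where f = "\<lambda>x. ev x t"]) (auto split: sum.splits)

lemma act_zw_tensor: "act_zw g (tensor_zw u f) = tensor_zw (act g u) (act_dual g f)"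
proof (rule pol_eqI_ev)
  fix z :: "zwvar \<Rightarrow> complex"
  have "mmul (\<lambda>v. z (z_tag v)) g = (\<lambda>v. mmul z g (z_tag v))"
    "mmul (\<lambda>v. z (w_tag v)) (contra g) = (\<lambda>v. mmul z (contra g) (w_tag v))"
    by (auto simp: mmul_def z_tag_def w_tag_def)
  then show "ev z (act_zw g (tensor_zw u f)) = ev z (tensor_zw (act g u) (act_dual g f))"
    by (simp add: ev_act_zw ev_tensor_zw ev_act act_dual_def)
      (simp add: z_tag_def w_tag_def case_prod_unfold)
qed

lemma act_zw_add: "act_zw g (t + t') = act_zw g t + act_zw g t'"
  by (simp add: act_zw_def subst_add)

text \<open>On a product tensor the dual action hits both arguments of the inner pairing and cancels
  by unitarity; what is left is the action on the factor in \<open>Z\<close>.\<close>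

lemma pairing_w_act:
  assumes g: "g \<in> Umat k"
  shows "pairing_w (lookup (act_zw g t)) (act_dual g f) = act g (pairing_w (lookup t) f)"
proof (induction t rule: pol_induct)
  case (single c d)
  have "contra g \<in> Umat k" using Umat_cnj_mat g by (simp add: contra_Umat[OF g])
  then have "pairing (act_dual g f') (act_dual g f) = pairing f' f" for f' :: "(nat \<times> nat) pol"
    by (simp add: act_dual_def pairing_act_act)
  then show ?case
    by (subst (1 2) single_as_tensor) (simp add: act_zw_tensor pairing_w_tensor act_smul)
qed (simp add: act_zw_add pairing_w_add_left act_add)

text \<open>On a product tensor each coefficient is a multiple of the factor in \<open>w\<close>,
  and \<open>Vmod\<close> is a subspace.\<close>

lemma zcoef_Tmod:
  assumes "t \<in> Tmod ms m k"
  shows "zcoef a t \<in> Vmod m k"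
  using assms unfolding Tmod_def
proof (induction rule: pol.span_induct)
  show "pol.subspace {t. zcoef a t \<in> Vmod m k}"
    using subspace_Vmod[of m k]
    by (auto simp: pol.subspace_def zcoef_add zcoef_smul)
qed (auto simp: zcoef_tensor pol.subspace_scale[OF subspace_Vmod])

lemma pairing_w_Tmod:
  assumes "t \<in> Tmod ms m k"
  shows "pairing_w (lookup t) f \<in> VZ ms k"
  using assms unfolding Tmod_def
proof (induction rule: pol.span_induct)
  show "pol.subspace {t. pairing_w (lookup t) f \<in> VZ ms k}"
    unfolding VZ_def
    by (auto simp: pol.subspace_def pairing_w_add_left pairing_w_smul_left
        pairing_w_0_left pol.span_zero intro: pol.span_add pol.span_scale)
next
  fix t assume "t \<in> {tensor_zw (tensor_z (length ms) F) f | F f.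
        (\<forall>i<length ms. F i \<in> Vmod (ms ! i) k) \<and> f \<in> Vmod m k}"
  then obtain F f' where "t = tensor_zw (tensor_z (length ms) F) f'"
    "\<forall>i<length ms. F i \<in> Vmod (ms ! i) k" by auto
  then show "pairing_w (lookup t) f \<in> VZ ms k"
    unfolding VZ_def
    by (simp only: pairing_w_tensor) (intro pol.span_scale pol.span_base, blast)
qed

section \<open>Torus weights\<close>

definition dmat :: "(nat \<Rightarrow> complex) \<Rightarrow> nat \<Rightarrow> nat \<Rightarrow> complex" where
  "dmat d = (\<lambda>s t. if s = t then d s else 0)"

lemma dmat_Umat:
  assumes "\<And>s. cmod (d s) = 1" "\<And>s. k \<le> s \<Longrightarrow> d s = 1"
  shows "dmat d \<in> Umat k"
proof -
  have d: "d s * cnj (d s) = 1" "cnj (d s) * d s = 1" for s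
    using complex_norm_square[of "d s"] assms(1)[of s] by (simp_all add: mult.commute)
  have "(\<Sum>u<k. (if s = u then d s else 0) * cnj (if t = u then d t else 0)) = (if s = t then 1 else 0)"
    if "s < k" for s t
  proof -
    have "(\<Sum>u<k. (if s = u then d s else 0) * cnj (if t = u then d t else 0))
        = (\<Sum>u<k. if u = s then (if s = t then 1 else 0) else 0)"
      by (intro sum.cong refl) (auto simp: d)
    with that show ?thesis by simp
  qed
  moreover have "(\<Sum>u<k. cnj (if u = s then d u else 0) * (if u = t then d u else 0)) = (if s = t then 1 else 0)"
    if "s < k" for s t
  proof -
    have "(\<Sum>u<k. cnj (if u = s then d u else 0) * (if u = t then d u else 0))
        = (\<Sum>u<k. if u = s then (if s = t then 1 else 0) else 0)"
      by (intro sum.cong refl) (auto simp: d)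
    with that show ?thesis by simp
  qed
  ultimately show ?thesis
    using assms(2) by (auto simp: Umat_def dmat_def)
qed

lemma mmul_dmat: "mmul z (dmat d) v = d (snd v) * z v"
proof (cases v)
  case (Pair \<rho> t)
  have "{s. dmat d s t \<noteq> 0} = (if d t = 0 then {} else {t})"
    by (auto simp: dmat_def)
  then show ?thesis by (simp add: Pair mmul_def) (simp add: dmat_def)
qed

lemma lookup_act_dmat: "lookup (act (dmat d) f) a = mon (\<lambda>v. d (snd v)) a * lookup f a"
proof (rule lookup_scale)
  have "mmul z (dmat d) = (\<lambda>v. d (snd v) * z v)" for z :: "'a \<times> nat \<Rightarrow> complex"
    by (rule ext) (rule mmul_dmat)
  then show "ev z (act (dmat d) f) = ev (\<lambda>v. d (snd v) * z v) f" for z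
    by (simp add: ev_act)
qed

lemma cnj_mat_dmat: "cnj_mat (dmat d) = dmat (\<lambda>s. cnj (d s))"
  by (auto simp: cnj_mat_def dmat_def fun_eq_iff)

lemma lookup_act_zw_dmat:
  assumes "dmat d \<in> Umat k"
  shows "lookup (act_zw (dmat d) t) c
    = mon (\<lambda>(\<rho>, s). case \<rho> of Inl _ \<Rightarrow> d s | Inr _ \<Rightarrow> cnj (d s)) c * lookup t c"
proof (rule lookup_scale)
  show "ev z (act_zw (dmat d) t)
      = ev (\<lambda>v. (case v of (\<rho>, s) \<Rightarrow> case \<rho> of Inl _ \<Rightarrow> d s | Inr _ \<Rightarrow> cnj (d s)) * z v) t" for z
    unfolding ev_act_zw contra_Umat[OF assms] cnj_mat_dmat
    by (intro arg_cong[where f = "\<lambda>x. ev x t"] ext) (auto simp: mmul_dmat split: sum.splits)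
qed

text \<open>Exponents have to be separated by numbers of modulus 1 because the torus is unitary.
  With \<open>N\<close> the difference of the exponents, the \<open>N\<close>-th power of
  \<open>cis (pi / N)\<close> is -1.\<close>

lemma exists_unit_power_neq:
  assumes "n \<noteq> (n' :: nat)"
  shows "\<exists>\<zeta>. cmod \<zeta> = 1 \<and> \<zeta> ^ n \<noteq> \<zeta> ^ n'"
proof -
  have *: "\<exists>\<zeta>. cmod \<zeta> = 1 \<and> \<zeta> ^ n \<noteq> \<zeta> ^ n'" if "n < n'" for n n' :: nat
  proof -
    define N where "N = n' - n"
    have N: "n' = n + N" "N > 0" using that by (auto simp: N_def)
    have "cis (pi / N) ^ N = -1" using N by (simp add: DeMoivre)
    then have "cis (pi / N) ^ n \<noteq> cis (pi / N) ^ n'"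
      by (simp add: N(1) power_add)
    then show ?thesis by (intro exI[of _ "cis (pi / N)"]) simp
  qed
  show ?thesis
    using *[of n n'] *[of n' n] assms by (metis linorder_neqE_nat)
qed

section \<open>Reduction of invariants to their truncations\<close>

lemma invariants_truncate:
  assumes "I \<in> invariants ms m" "k \<ge> sum_list (map length ms) + length m"
  obtains t where "t \<in> Tmod ms m k" "\<And>g. g \<in> Umat k \<Longrightarrow> act_zw g t = t" "lookup t = truncate k I"
  using assms by (auto simp: invariants_def)

text \<open>The torus forces equal degrees in column \<open>s\<close> of \<open>Z\<close> and of \<open>w\<close>.\<close>
lemma invariants_columns:
  assumes I: "I \<in> invariants ms m" and c: "I c \<noteq> 0"
    and w: "\<And>v. v \<in> keys (wpart c) \<Longrightarrow> snd v < k" and v0: "v0 \<in> keys c"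
  shows "snd v0 < k"
proof (rule ccontr)
  assume "\<not> snd v0 < k"
  define s where "s = snd v0"
  have "k \<le> s" using \<open>\<not> snd v0 < k\<close> by (simp add: s_def)
  \<comment> \<open>Large enough for the truncation to retain \<open>c\<close> and to be an
    invariant tensor, which requires at least \<open>p + q\<close> columns.\<close>
  define K where "K = Suc (Max (snd ` keys c)) + sum_list (map length ms) + length m"
  have K: "snd v < K" if "v \<in> keys c" for v
    using that Max_ge[of "snd ` keys c" "snd v"] by (simp add: K_def less_Suc_eq_le trans_le_add1)
  obtain t where t: "\<And>g. g \<in> Umat K \<Longrightarrow> act_zw g t = t" "lookup t = truncate K I"
    by (rule invariants_truncate[OF I, of K]) (auto simp: K_def)
  have tc: "lookup t c \<noteq> 0" using K c by (auto simp: t truncate_def)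
  \<comment> \<open>The total degree of \<open>c\<close> in column \<open>s\<close>; it is positive
    because \<open>v0\<close> lies in that column.\<close>
  define N where "N = (\<Sum>v\<in>keys c. if snd v = s then lookup c v else 0)"
  have "lookup c v0 \<le> N"
    unfolding N_def using member_le_sum[of v0 "keys c" "\<lambda>v. if snd v = s then lookup c v else 0"] v0
    by (simp add: s_def)
  then have "N \<noteq> 0" using v0 by (simp add: in_keys_iff)
  then obtain \<zeta> where \<zeta>: "cmod \<zeta> = 1" "\<zeta> ^ N \<noteq> 1"
    using exists_unit_power_neq[of N 0] by auto
  define d where "d = (\<lambda>_. 1)(s := \<zeta>)"
  have d: "dmat d \<in> Umat K"
    by (rule dmat_Umat) (use \<zeta> K[OF v0] in \<open>auto simp: d_def s_def\<close>)
  have "mon (\<lambda>(\<rho>, s). case \<rho> of Inl _ \<Rightarrow> d s | Inr _ \<Rightarrow> cnj (d s)) c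
      = (\<Prod>v\<in>keys c. \<zeta> ^ (if snd v = s then lookup c v else 0))"
    unfolding mon_def
  proof (intro prod.cong refl)
    fix v assume v: "v \<in> keys c"
    show "(case v of (\<rho>, s) \<Rightarrow> case \<rho> of Inl _ \<Rightarrow> d s | Inr _ \<Rightarrow> cnj (d s)) ^ lookup c v
        = \<zeta> ^ (if snd v = s then lookup c v else 0)"
    proof (cases "snd v = s")
      case True
      \<comment> \<open>Column \<open>s\<close> of \<open>w\<close> is excluded by hypothesis, so no
        conjugate factor can cancel the powers of \<open>\<zeta>\<close> coming from
        \<open>Z\<close>.\<close>
      have "fst v \<noteq> Inr \<beta>" for \<beta>
      proof
        assume "fst v = Inr \<beta>"
        then have "v = w_tag (\<beta>, s)" using True by (cases v) (auto simp: w_tag_def)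
        then have "(\<beta>, s) \<in> keys (wpart c)" using v by (simp add: in_keys_iff)
        from w[OF this] show False using \<open>k \<le> s\<close> by simp
      qed
      then obtain \<rho> where "v = (Inl \<rho>, s)" using True by (cases v, cases "fst v") auto
      then show ?thesis by (simp add: d_def)
    qed (auto simp: d_def split: prod.splits sum.splits)
  qed
  also have "\<dots> = \<zeta> ^ N" by (simp add: N_def power_sum)
  finally have "lookup (act_zw (dmat d) t) c = \<zeta> ^ N * lookup t c"
    by (simp only: lookup_act_zw_dmat[OF d])
  then show False using t(1)[OF d] tc \<zeta> by simp
qed

text \<open>A monomial contributes only if its part in \<open>w\<close> occurs in \<open>f\<close>,
  and equality of column degrees then confines its part in \<open>Z\<close> to the same columns. The
  summands agree one by one, so the two \<open>Sum_any\<close> coincide whatever their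
  support.\<close>

lemma pairing_w_truncate:
  assumes I: "I \<in> invariants ms m" and f: "\<And>v. v \<in> vars f \<Longrightarrow> snd v < k"
  shows "pairing_w I f = pairing_w (truncate k I) f"
proof -
  have "I c * at_zero (partial_mono (wpart c) (conj_pol f))
      = truncate k I c * at_zero (partial_mono (wpart c) (conj_pol f))" for c
  proof (cases "lookup f (wpart c) = 0 \<or> I c = 0")
    case False
    then have "wpart c \<in> keys f" by (simp add: in_keys_iff)
    then have "\<And>v. v \<in> keys (wpart c) \<Longrightarrow> snd v < k"
      using f unfolding vars_def by blast
    with invariants_columns[OF I] False show ?thesis by (auto simp: truncate_def)
  qed (auto simp: at_zero_partial_mono truncate_def)
  then show ?thesis unfolding pairing_w_def by presburger
qed

lemma pairing_ser_truncate:
  assumes "\<And>v. v \<in> vars f \<Longrightarrow> snd v < k"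
  shows "pairing_ser F f = pairing_ser (truncate k F) f"
  unfolding pairing_ser_eq using assms
  by (intro sum.cong refl) (auto simp: truncate_def vars_def)

lemma finite_vars: "finite (vars f)"
  by (simp add: vars_def)

lemma vars_columns_bound:
  assumes "finite A"
  obtains k where "\<And>f v. f \<in> A \<Longrightarrow> v \<in> vars f \<Longrightarrow> snd v < (k :: nat)"
proof
  have fin: "finite (\<Union>f\<in>A. snd ` vars f)" using assms finite_vars by blast
  show "snd v < Suc (Max (\<Union>f\<in>A. snd ` vars f))" if "f \<in> A" "v \<in> vars f" for f v
    using that by (intro le_imp_less_Suc Max_ge fin) auto
qed

section \<open>Any two nonzero invariant subspaces intersect\<close>

text \<open>The signature as an exponent vector, comparable with the row degrees
  \<open>mono_image fst a\<close> and the column degrees \<open>mono_image snd a\<close>.\<close>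

definition weight :: "nat list \<Rightarrow> nat mono" where
  "weight m = (\<Sum>i<length m. single i (m ! i))"

lemma mon_weight: "mon x (weight m) = (\<Prod>i<length m. x i ^ (m ! i))"
  by (simp add: weight_def mon_sum)

text \<open>Points without zero coordinates suffice; these are the diagonals of invertible diagonal
  matrices.\<close>

lemma mono_eqI_mon:
  assumes "\<And>x. (\<And>v. x v \<noteq> 0) \<Longrightarrow> mon x a = mon x b"
  shows "a = b"
proof (rule poly_mapping_eqI)
  fix v
  have "mon ((\<lambda>_. 1)(v := 2)) a = mon ((\<lambda>_. 1)(v := 2)) b"
    by (rule assms) auto
  then have "(2::complex) ^ lookup a v = 2 ^ lookup b v"
    by (simp only: mon_update_one)
  then have "(of_nat (2 ^ lookup a v) :: complex) = of_nat (2 ^ lookup b v)" by simp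
  then show "lookup a v = lookup b v" by (simp only: of_nat_eq_iff) simp
qed

lemma Vmod_vars: "f \<in> Vmod m k \<Longrightarrow> v \<in> vars f \<Longrightarrow> fst v < length m \<and> snd v < k"
  by (auto simp: Vmod_iff)

lemma Vmod_ev_lmul:
  assumes "f \<in> Vmod m k" "inv_lower_triangular (length m) b"
  shows "ev (lmul (length m) b z) f = mon (\<lambda>\<alpha>. b \<alpha> \<alpha>) (weight m) * ev z f"
  using assms by (simp add: Vmod_iff mon_weight)

text \<open>Under an invertible diagonal \<open>b\<close> the transformation law multiplies every
  monomial by the same factor, which fixes its row degrees.\<close>

lemma Vmod_row_weight:
  assumes f: "f \<in> Vmod m k" and a: "a \<in> keys f"
  shows "mono_image fst a = weight m"
proof (rule mono_eqI_mon)
  fix x :: "nat \<Rightarrow> complex" assume x: "\<And>i. x i \<noteq> 0"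
  define b where "b = (\<lambda>\<alpha> \<beta>. if \<alpha> = \<beta> then x \<alpha> else 0)"
  define c where "c = (\<lambda>\<alpha> \<beta>. if \<alpha> = \<beta> then inverse (x \<alpha>) else 0)"
  have "(\<Sum>\<gamma><length m. b \<alpha> \<gamma> * c \<gamma> \<beta>) = (if \<alpha> = \<beta> then 1 else 0)"
    "(\<Sum>\<gamma><length m. c \<alpha> \<gamma> * b \<gamma> \<beta>) = (if \<alpha> = \<beta> then 1 else 0)"
    if "\<alpha> < length m" for \<alpha> \<beta>
  proof -
    have "(\<Sum>\<gamma><length m. b \<alpha> \<gamma> * c \<gamma> \<beta>) = (\<Sum>\<gamma><length m. if \<gamma> = \<alpha> then if \<alpha> = \<beta> then 1 else 0 else 0)"
      "(\<Sum>\<gamma><length m. c \<alpha> \<gamma> * b \<gamma> \<beta>) = (\<Sum>\<gamma><length m. if \<gamma> = \<alpha> then if \<alpha> = \<beta> then 1 else 0 else 0)"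
      by (intro sum.cong refl; use x in \<open>auto simp: b_def c_def\<close>)+
    with that show "(\<Sum>\<gamma><length m. b \<alpha> \<gamma> * c \<gamma> \<beta>) = (if \<alpha> = \<beta> then 1 else 0)"
      "(\<Sum>\<gamma><length m. c \<alpha> \<gamma> * b \<gamma> \<beta>) = (if \<alpha> = \<beta> then 1 else 0)" by simp_all
  qed
  then have b: "inv_lower_triangular (length m) b"
    unfolding inv_lower_triangular_def by (auto simp: b_def intro!: exI[of _ c])
  have "lookup (mon x (weight m) *\<^sub>P f) a = mon (\<lambda>v. x (fst v)) a * lookup f a"
  proof (rule lookup_scale)
    fix z
    have "ev (lmul (length m) b z) f = ev (\<lambda>v. x (fst v) * z v) f"
    proof (rule ev_cong)
      fix v assume "v \<in> vars f"
      with Vmod_vars[OF f] obtain i j where v: "v = (i, j)" "i < length m" by (cases v) auto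
      have "(\<Sum>\<beta><length m. b i \<beta> * z (\<beta>, j)) = (\<Sum>\<beta><length m. if \<beta> = i then x i * z (i, j) else 0)"
        by (intro sum.cong refl) (auto simp: b_def)
      then show "lmul (length m) b z v = x (fst v) * z v"
        using v by (simp add: lmul_def)
    qed
    with Vmod_ev_lmul[OF f b, of z]
    show "ev z (mon x (weight m) *\<^sub>P f) = ev (\<lambda>v. x (fst v) * z v) f"
      by (simp add: b_def)
  qed
  with a show "mon x (mono_image fst a) = mon x (weight m)"
    by (simp add: mon_mono_image in_keys_iff)
qed

text \<open>Row degrees extend the scaling law to all \<open>x\<close>, including those with zero
  entries, where the diagonal matrix is singular; \<open>ev_diagonal\<close> relies on this.\<close>

lemma ev_scale_rows:
  assumes "f \<in> Vmod m k"
  shows "ev (\<lambda>v. x (fst v) * z v) f = mon x (weight m) * ev z f"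
proof -
  have "mon (\<lambda>v. x (fst v)) a = mon x (weight m)" if "a \<in> keys f" for a
    using Vmod_row_weight[OF assms that] by (metis mon_mono_image)
  then show ?thesis
    by (simp add: ev_def mon_mult sum_distrib_left mult_ac)
qed

lemma ev_scale_columns:
  assumes "\<And>a. a \<in> keys f \<Longrightarrow> mono_image snd a = w"
  shows "ev (\<lambda>v. z v * x (snd v)) f = mon x w * ev z f"
proof -
  have "mon (\<lambda>v. x (snd v)) a = mon x w" if "a \<in> keys f" for a
    using assms[OF that] by (metis mon_mono_image)
  then show ?thesis
    by (simp add: ev_def mon_mult sum_distrib_left mult_ac)
qed

lemma ev_limit:
  fixes p :: "complex \<Rightarrow> 'v \<Rightarrow> complex"
  assumes cont: "\<And>v. isCont (\<lambda>s. p s v) 0" and eq: "\<And>s. s \<noteq> 0 \<Longrightarrow> ev (p s) f = c"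
  shows "ev (p 0) f = c"
proof -
  have "isCont (\<lambda>s. ev (p s) f) 0"
    unfolding ev_def mon_def by (intro continuous_intros cont)
  then have "((\<lambda>s. ev (p s) f) \<longlongrightarrow> ev (p 0) f) (at 0)"
    by (simp add: isCont_def)
  moreover have "((\<lambda>s. ev (p s) f) \<longlongrightarrow> c) (at 0)"
    by (rule tendsto_eventually) (auto simp: eventually_at_filter eq)
  ultimately show ?thesis
    using tendsto_unique[of "at (0::complex)"] by auto
qed

section \<open>Gaussian elimination on the left\<close>

lemma inv_lower_triangular_elimination:
  assumes "a < q"
  shows "inv_lower_triangular q (\<lambda>i j. (if i = j then 1 else 0) + (if j = a \<and> a < i then c i else 0))"
    (is "inv_lower_triangular q ?b")
proof -
  let ?c = "\<lambda>i j. (if i = j then 1 else 0) - (if j = a \<and> a < i then c i else (0::complex))"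
  have s1: "(\<Sum>\<gamma><q. ?b \<alpha> \<gamma> * u \<gamma>) = u \<alpha> + (if a < \<alpha> then c \<alpha> * u a else 0)" if "\<alpha> < q" for \<alpha> u
  proof -
    have "(\<Sum>\<gamma><q. ?b \<alpha> \<gamma> * u \<gamma>)
        = (\<Sum>\<gamma><q. (if \<gamma> = \<alpha> then u \<alpha> else 0) + (if \<gamma> = a then if a < \<alpha> then c \<alpha> * u a else 0 else 0))"
      by (intro sum.cong refl) (auto simp: distrib_right)
    with that assms show ?thesis by (simp add: sum.distrib)
  qed
  have s2: "(\<Sum>\<gamma><q. ?c \<alpha> \<gamma> * u \<gamma>) = u \<alpha> - (if a < \<alpha> then c \<alpha> * u a else 0)" if "\<alpha> < q" for \<alpha> u
  proof -
    have "(\<Sum>\<gamma><q. ?c \<alpha> \<gamma> * u \<gamma>)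
        = (\<Sum>\<gamma><q. (if \<gamma> = \<alpha> then u \<alpha> else 0) - (if \<gamma> = a then if a < \<alpha> then c \<alpha> * u a else 0 else 0))"
      by (intro sum.cong refl) (auto simp: left_diff_distrib)
    with that assms show ?thesis by (simp add: sum_subtractf)
  qed
  show ?thesis
    unfolding inv_lower_triangular_def
  proof (intro conjI exI[of _ ?c] allI impI)
    fix \<alpha> \<beta> assume "\<alpha> < q" "\<beta> < q"
    then show "(\<Sum>\<gamma><q. ?b \<alpha> \<gamma> * ?c \<gamma> \<beta>) = (if \<alpha> = \<beta> then 1 else 0)"
      "(\<Sum>\<gamma><q. ?c \<alpha> \<gamma> * ?b \<gamma> \<beta>) = (if \<alpha> = \<beta> then 1 else 0)"
      by (simp_all only: s1 s2) auto
  qed auto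
qed

text \<open>Adding multiples of row \<open>a\<close> to later rows is left multiplication by a
  unipotent lower triangular matrix, whose diagonal factor is 1.\<close>

lemma ev_eliminate:
  assumes f: "f \<in> Vmod m k" and a: "a < length m"
  shows "ev (\<lambda>(i, t). z (i, t) + (if a < i then c i * z (a, t) else 0)) f = ev z f"
proof -
  let ?b = "\<lambda>i j. (if i = j then 1 else 0) + (if j = a \<and> a < i then c i else 0)"
  have "ev (lmul (length m) ?b z) f = ev (\<lambda>(i, t). z (i, t) + (if a < i then c i * z (a, t) else 0)) f"
  proof (rule ev_cong)
    fix v assume "v \<in> vars f"
    with Vmod_vars[OF f] obtain i t where v: "v = (i, t)" "i < length m" by (cases v) auto
    have "(\<Sum>\<gamma><length m. ?b i \<gamma> * z (\<gamma>, t))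
        = (\<Sum>\<gamma><length m. (if \<gamma> = i then z (i, t) else 0)
            + (if \<gamma> = a then if a < i then c i * z (a, t) else 0 else 0))"
      by (intro sum.cong refl) (auto simp: distrib_right)
    with v a show "lmul (length m) ?b z v
        = (case v of (i, t) \<Rightarrow> z (i, t) + (if a < i then c i * z (a, t) else 0))"
      by (simp add: lmul_def sum.distrib)
  qed
  moreover have "(\<lambda>\<alpha>. ?b \<alpha> \<alpha>) = (\<lambda>_. 1)" by auto
  ultimately show ?thesis
    using Vmod_ev_lmul[OF f inv_lower_triangular_elimination[OF a], of c z] by simp
qed

text \<open>Column by column elimination brings \<open>z\<close> to upper triangular form without
  changing the value of \<open>f\<close>. The class \<open>R\<close> records what survives the
  moves: used with lower triangular matrices, the result is diagonal; used with all matrices, it is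
  merely upper triangular.\<close>

lemma vanishes_by_elimination:
  assumes f: "f \<in> Vmod m k" and q: "length m \<le> k"
    and upper: "\<And>z. R z \<Longrightarrow> (\<And>i j. i < length m \<Longrightarrow> j < i \<Longrightarrow> z (i, j) = 0) \<Longrightarrow> ev z f = 0"
    and R_upd: "\<And>z a s. R z \<Longrightarrow> R (z((a, a) := s))"
    and R_elim: "\<And>z a c. R z \<Longrightarrow> R (\<lambda>(i, t). z (i, t) + (if a < i then c i * z (a, t) else 0))"
    and "R z"
  shows "ev z f = 0"
proof -
  have "\<forall>z. R z \<longrightarrow> (\<forall>j<a. \<forall>i<length m. j < i \<longrightarrow> z (i, j) = 0) \<longrightarrow> ev z f = 0" if "a \<le> length m" for a
    using that
  proof (induction rule: inc_induct)
    case base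
    show ?case using upper by auto
  next
    case (step a)
    have nonzero: "ev z f = 0" if z: "R z" "\<forall>j<a. \<forall>i<length m. j < i \<longrightarrow> z (i, j) = 0" "z (a, a) \<noteq> 0" for z
    proof -
      let ?z = "\<lambda>(i, t). z (i, t) + (if a < i then (- z (i, a) / z (a, a)) * z (a, t) else 0)"
      have "\<forall>j<Suc a. \<forall>i<length m. j < i \<longrightarrow> ?z (i, j) = 0"
        using z step.hyps by (auto simp: less_Suc_eq)
      moreover have "R ?z" using R_elim[OF z(1), of a "\<lambda>i. - z (i, a) / z (a, a)"] .
      ultimately have "ev ?z f = 0" using step.IH by blast
      then show ?thesis
        using ev_eliminate[OF f \<open>a < length m\<close>, of z "\<lambda>i. - z (i, a) / z (a, a)"] by simp
    qed
    show ?case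
    proof (intro allI impI)
      fix z assume z: "R z" "\<forall>j<a. \<forall>i<length m. j < i \<longrightarrow> z (i, j) = 0"
      show "ev z f = 0"
      proof (cases "z (a, a) = 0")
        case True
        \<comment> \<open>A vanishing pivot is replaced by \<open>s \<noteq> 0\<close>, where
          elimination works, and the value at 0 follows by continuity.\<close>
        have "ev (z((a, a) := 0)) f = 0"
        proof (rule ev_limit[where p = "\<lambda>s. z((a, a) := s)"])
          show "isCont (\<lambda>s. (z((a, a) := s)) v) 0" for v
            by (cases "v = (a, a)") auto
          show "ev (z((a, a) := s)) f = 0" if "s \<noteq> 0" for s
            by (rule nonzero) (use that R_upd z in auto)
        qed
        with True show ?thesis by (metis fun_upd_triv)
      qed (use nonzero z in blast)
    qed
  qed
  from this[of 0] \<open>R z\<close> show ?thesis by simp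
qed

text \<open>The base point \<open>(1 0)\<close> of the evaluation, for any number of rows and
  columns.\<close>

definition idmat :: "nat \<times> nat \<Rightarrow> complex" where
  "idmat = (\<lambda>(i, j). if i = j then 1 else 0)"

lemma ev_diagonal:
  assumes f: "f \<in> Vmod m k" and "ev idmat f = 0"
    and "\<And>i j. i < length m \<Longrightarrow> j < k \<Longrightarrow> i \<noteq> j \<Longrightarrow> z (i, j) = 0"
  shows "ev z f = 0"
proof -
  have "ev z f = ev (\<lambda>v. z (fst v, fst v) * idmat v) f"
    by (rule ev_cong) (use assms(3) Vmod_vars[OF f] in \<open>auto simp: idmat_def split: prod.splits\<close>)
  also have "\<dots> = 0" using ev_scale_rows[OF f, of "\<lambda>i. z (i, i)" idmat] assms(2) by simp
  finally show ?thesis .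
qed

text \<open>A singular lower triangular matrix is outside the transformation law; elimination, which
  keeps it lower triangular, leads to a diagonal one, i.e. to the base point with scaled
  rows.\<close>

lemma ev_lower_triangular:
  assumes f: "f \<in> Vmod m k" and q: "length m \<le> k" and E: "ev idmat f = 0"
    and z: "\<And>i j. i < j \<Longrightarrow> j < k \<Longrightarrow> z (i, j) = 0"
  shows "ev z f = 0"
proof (rule vanishes_by_elimination[OF f q, where R = "\<lambda>z. \<forall>i j. i < j \<longrightarrow> j < k \<longrightarrow> z (i, j) = 0"])
  show "ev z f = 0" if "\<forall>i j. i < j \<longrightarrow> j < k \<longrightarrow> z (i, j) = 0"
    "\<And>i j. i < length m \<Longrightarrow> j < i \<Longrightarrow> z (i, j) = 0" for z
    by (rule ev_diagonal[OF f E]) (use that in \<open>metis linorder_neqE_nat\<close>)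
qed (use z in auto)

text \<open>
  Conjugation with \<open>diag(1, s, s\<^sup>2, \<dots>)\<close>, \<open>s \<rightarrow> 0\<close>, contracts an upper triangular matrix to its
  diagonal, and a polynomial of weight \<open>m\<close> does not notice it.
\<close>
lemma weight_vector_eq_0:
  assumes f: "f \<in> Vmod m k" and q: "length m \<le> k" and E: "ev idmat f = 0"
    and w: "\<And>a. a \<in> keys f \<Longrightarrow> mono_image snd a = weight m"
  shows "f = 0"
proof (rule pol_eqI_ev)
  fix z
  have "ev z f = 0"
  proof (rule vanishes_by_elimination[OF f q, where R = "\<lambda>_. True"])
    fix z :: "nat \<times> nat \<Rightarrow> complex"
    assume upper: "\<And>i j. i < length m \<Longrightarrow> j < i \<Longrightarrow> z (i, j) = 0"
    \<comment> \<open>The conjugated entry \<open>s^(-i) z(i,j) s^j\<close>, written with exponent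
      \<open>j - i\<close> to make sense at \<open>s = 0\<close>, where \<open>0 ^ 0 = 1\<close>
      retains exactly the diagonal.\<close>
    define p where "p = (\<lambda>s :: complex. \<lambda>(i :: nat, j :: nat). if i \<le> j then z (i, j) * s ^ (j - i) else 0)"
    have "ev (p 0) f = ev z f"
    proof (rule ev_limit)
      show "isCont (\<lambda>s. p s v) 0" for v
        by (cases v; cases "fst v \<le> snd v") (auto simp: p_def intro!: continuous_intros)
      fix s :: complex assume s: "s \<noteq> 0"
      have "ev (p s) f = ev (\<lambda>v. (inverse s ^ fst v * z v) * s ^ snd v) f"
      proof (rule ev_cong)
        fix v assume "v \<in> vars f"
        with Vmod_vars[OF f] obtain i j where v: "v = (i, j)" "i < length m" by (cases v) auto
        show "p s v = (inverse s ^ fst v * z v) * s ^ snd v"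
        proof (cases "i \<le> j")
          case True
          then have "s ^ j = s ^ i * s ^ (j - i)" by (simp flip: power_add)
          with True s show ?thesis by (simp add: v p_def field_simps)
        qed (use v upper in \<open>simp add: p_def\<close>)
      qed
      \<comment> \<open>Row degrees and column degrees are both \<open>weight m\<close>, so the two
        scalings contribute inverse factors.\<close>
      also have "\<dots> = mon (\<lambda>j. s ^ j) (weight m) * (mon (\<lambda>i. inverse s ^ i) (weight m) * ev z f)"
        using ev_scale_columns[OF w, of f "\<lambda>v. inverse s ^ fst v * z v" "\<lambda>j. s ^ j"]
          ev_scale_rows[OF f, of "\<lambda>i. inverse s ^ i" z] by simp
      also have "\<dots> = mon (\<lambda>i. s ^ i * inverse s ^ i) (weight m) * ev z f"
        by (simp only: mon_mult mult.assoc)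
      also have "(\<lambda>i. s ^ i * inverse s ^ i) = (\<lambda>_. 1)"
        using s by (simp flip: power_mult_distrib)
      finally show "ev (p s) f = ev z f" by simp
    qed
    moreover have "ev (p 0) f = 0"
      by (rule ev_diagonal[OF f E]) (auto simp: p_def)
    ultimately show "ev z f = 0" by simp
  qed auto
  then show "ev z f = ev z 0" by simp
qed

section \<open>Givens rotations and the reduction of a matrix to lower triangular form\<close>

definition givens :: "nat \<Rightarrow> nat \<Rightarrow> complex \<Rightarrow> complex \<Rightarrow> nat \<Rightarrow> nat \<Rightarrow> complex" where
  "givens a t x y = (\<lambda>s u.
     if s = a \<and> u = a then x else if s = a \<and> u = t then y
     else if s = t \<and> u = a then - cnj y else if s = t \<and> u = t then cnj x
     else if s = u then 1 else 0)"

lemma sum_split_two: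
  fixes F :: "nat \<Rightarrow> complex"
  assumes "a < k" "t < k" "a \<noteq> t"
  shows "(\<Sum>u<k. F u) = F a + F t + (\<Sum>u\<in>{..<k} - {a, t}. F u)"
  using assms by (simp add: sum.remove[of _ a] sum.remove[of _ t] insert_commute
      Diff_insert[symmetric] add.assoc)

lemma adj_givens: "a \<noteq> t \<Longrightarrow> adj (givens a t x y) = givens a t (cnj x) (- y)"
  by (auto simp: fun_eq_iff adj_def givens_def)

lemma givens_rows:
  assumes a: "a < k" "t < k" "a \<noteq> t" and n: "x * cnj x + y * cnj y = 1" and s: "s < k"
  shows "(\<Sum>u<k. givens a t x y s u * cnj (givens a t x y v u)) = (if s = v then 1 else 0)"
proof -
  have n': "cnj y * y + cnj x * x = 1" using n by (simp add: add.commute mult.commute)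
  have "(\<Sum>u\<in>{..<k} - {a, t}. givens a t x y s u * cnj (givens a t x y v u))
      = (\<Sum>u\<in>{..<k} - {a, t}. if u = s then if s = v then 1 else 0 else 0)"
    by (intro sum.cong refl) (auto simp: givens_def)
  also have "\<dots> = (if s = v \<and> s \<noteq> a \<and> s \<noteq> t then 1 else 0)" using s by auto
  finally have rest: "(\<Sum>u\<in>{..<k} - {a, t}. givens a t x y s u * cnj (givens a t x y v u))
      = (if s = v \<and> s \<noteq> a \<and> s \<noteq> t then 1 else 0)" .
  show ?thesis
    unfolding sum_split_two[OF a] rest using a(3)
    by (cases "s = a"; cases "s = t"; cases "v = a"; cases "v = t")
      (simp_all add: givens_def n n' mult.commute[of "cnj y" "cnj x"])
qed

lemma givens_Umat:
  assumes a: "a < k" "t < k" "a \<noteq> t" and n: "x * cnj x + y * cnj y = 1"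
  shows "givens a t x y \<in> Umat k"
proof -
  \<comment> \<open>Columns of a rotation are conjugated rows of its adjoint, and the adjoint is
    again a rotation.\<close>
  have "(\<Sum>u<k. cnj (givens a t x y u s) * givens a t x y u v) = (if s = v then 1 else 0)"
    if "s < k" for s v
  proof -
    have "(\<Sum>u<k. adj (givens a t x y) s u * cnj (adj (givens a t x y) v u)) = (if s = v then 1 else 0)"
      unfolding adj_givens[OF a(3)]
      by (rule givens_rows[OF a _ that]) (use n in \<open>simp add: mult.commute\<close>)
    then show ?thesis by (simp add: adj_def)
  qed
  moreover have "givens a t x y s u = (if s = u then 1 else 0)" if "k \<le> s \<or> k \<le> u" for s u
  proof -
    have "\<not> (s = a \<and> u = a)" "\<not> (s = a \<and> u = t)" "\<not> (s = t \<and> u = a)" "\<not> (s = t \<and> u = t)"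
      using that a by linarith+
    then show ?thesis unfolding givens_def by argo
  qed
  ultimately show ?thesis
    using givens_rows[OF assms] unfolding Umat_def mem_Collect_eq by blast
qed

lemma mmul_givens:
  assumes a: "a < k" "t < k" "a \<noteq> t" and n: "x * cnj x + y * cnj y = 1"
  shows "mmul z (givens a t x y) (i, u) =
    (if u = a then x * z (i, a) - cnj y * z (i, t)
     else if u = t then y * z (i, a) + cnj x * z (i, t) else z (i, u))"
proof (cases "u < k")
  case True
  have "(\<Sum>s\<in>{..<k} - {a, t}. givens a t x y s u * z (i, s))
      = (\<Sum>s\<in>{..<k} - {a, t}. if s = u then z (i, u) else 0)"
    by (intro sum.cong refl) (auto simp: givens_def)
  then show ?thesis
    using a True unfolding mmul_Umat[OF givens_Umat[OF assms]] sum_split_two[OF a]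
    by (auto simp: givens_def)
qed (use a in \<open>auto simp: mmul_Umat[OF givens_Umat[OF assms]]\<close>)

text \<open>Entries above the diagonal are rotated away one at a time, by rows and within a row from
  left to right. Since \<open>f\<close> at \<open>z\<close> equals \<open>act g f\<close> at
  \<open>z\<close> times the inverse of \<open>g\<close>, the polynomial changes along the way;
  therefore the induction speaks of all elements of \<open>K\<close>.\<close>

lemma invariant_vanishing:
  assumes K: "K \<subseteq> Vmod m k" and inv: "\<And>g f. g \<in> Umat k \<Longrightarrow> f \<in> K \<Longrightarrow> act g f \<in> K"
    and q: "length m \<le> k" and E: "\<And>f. f \<in> K \<Longrightarrow> ev idmat f = 0" and "f \<in> K"
  shows "f = 0"
proof -
  have "\<forall>z. (\<forall>i<a. \<forall>j<k. i < j \<longrightarrow> z (i, j) = 0) \<longrightarrow> (\<forall>f\<in>K. ev z f = 0)" if "a \<le> k" for a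
    using that
  proof (induction rule: inc_induct)
    case base
    show ?case
    proof (intro allI impI ballI)
      fix z :: "nat \<times> nat \<Rightarrow> complex" and f
      assume z: "\<forall>i<k. \<forall>j<k. i < j \<longrightarrow> z (i, j) = 0" and f: "f \<in> K"
      from f K have "f \<in> Vmod m k" by blast
      then show "ev z f = 0"
        by (rule ev_lower_triangular[OF _ q E[OF f]]) (use z in \<open>meson less_trans\<close>)
    qed
  next
    case (step a)
    have "\<forall>z. (\<forall>i<a. \<forall>j<k. i < j \<longrightarrow> z (i, j) = 0) \<longrightarrow> (\<forall>j<t. a < j \<longrightarrow> z (a, j) = 0)
        \<longrightarrow> (\<forall>f\<in>K. ev z f = 0)" if "Suc a \<le> t" "t \<le> k" for t
      using that(2,1)
    proof (induction rule: inc_induct)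
      case base
      then show ?case using step.IH by (auto simp: less_Suc_eq)
    next
      case (step t)
      then have at: "a < k" "t < k" "a \<noteq> t" "a < t" by auto
      show ?case
      proof (intro allI impI ballI)
        fix z :: "nat \<times> nat \<Rightarrow> complex" and f
        assume z: "\<forall>i<a. \<forall>j<k. i < j \<longrightarrow> z (i, j) = 0" "\<forall>j<t. a < j \<longrightarrow> z (a, j) = 0" and "f \<in> K"
        show "ev z f = 0"
        proof (cases "z (a, t) = 0")
          case True
          then show ?thesis using step.IH step.prems z \<open>f \<in> K\<close> by (auto simp: less_Suc_eq)
        next
          case False
          \<comment> \<open>The norm of the pair to be rotated: with \<open>x\<close> and
            \<open>y\<close> below, the pair \<open>(z (a, a), z (a, t))\<close> goes to
            \<open>(n, 0)\<close>.\<close>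
          define n :: complex where "n = of_real (sqrt ((cmod (z (a, a)))\<^sup>2 + (cmod (z (a, t)))\<^sup>2))"
          have "n * n = of_real ((cmod (z (a, a)))\<^sup>2 + (cmod (z (a, t)))\<^sup>2)"
            unfolding n_def of_real_mult[symmetric] by simp
          then have nn: "n * n = z (a, a) * cnj (z (a, a)) + z (a, t) * cnj (z (a, t))"
            by (simp only: of_real_add complex_norm_square)
          have "(cmod (z (a, a)))\<^sup>2 + (cmod (z (a, t)))\<^sup>2 \<noteq> 0"
            using False by (simp add: sum_power2_eq_zero_iff)
          then have n0: "n \<noteq> 0" by (simp add: n_def)
          have cn: "cnj n = n" by (simp add: n_def)
          define x where "x = z (a, a) / n"
          define y where "y = z (a, t) / n"
          have xy: "x * cnj x + y * cnj y = 1"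
          proof -
            have "x * cnj x + y * cnj y
                = (z (a, a) * cnj (z (a, a)) + z (a, t) * cnj (z (a, t))) / (n * n)"
              by (simp add: x_def y_def cn add_divide_distrib)
            then show ?thesis using n0 by (simp flip: nn)
          qed
          define z' where "z' = mmul z (adj (givens a t x y))"
          note g = givens_Umat[OF at(1-3) xy]
          have z': "z' (i, u) = (if u = a then cnj x * z (i, a) + cnj y * z (i, t)
              else if u = t then - y * z (i, a) + x * z (i, t) else z (i, u))" for i u
            unfolding z'_def adj_givens[OF at(3)] by (subst mmul_givens[OF at(1-3)]) (use xy in \<open>simp_all add: mult.commute\<close>)
          have "- y * z (a, a) + x * z (a, t) = 0"
            by (simp add: x_def y_def)
          \<comment> \<open>Earlier rows stay cleared because both rotated columns lie to the right
            of their diagonal entry, and row \<open>a\<close> changes only in columns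
            \<open>a\<close> and \<open>t\<close>.\<close>
          then have "\<forall>i<a. \<forall>j<k. i < j \<longrightarrow> z' (i, j) = 0" "\<forall>j<Suc t. a < j \<longrightarrow> z' (a, j) = 0"
            using z at by (auto simp: z' less_Suc_eq)
          then have "ev z' (act (givens a t x y) f) = 0"
            using step.IH step.prems inv[OF g \<open>f \<in> K\<close>] by auto
          moreover have "mmul z' (givens a t x y) = z"
            using mmul_adj[OF Umat_adj[OF g], of z] by (simp add: z'_def)
          ultimately show ?thesis by (simp add: ev_act)
        qed
      qed
    qed
    from this[of "Suc a"] show ?case using step.hyps by auto
  qed
  from this[of 0] have "ev z f = 0" for z using \<open>f \<in> K\<close> by auto
  then show ?thesis by (intro pol_eqI_ev) simp
qed

section \<open>Weight components under the torus\<close>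

definition wcomp :: "nat mono \<Rightarrow> (nat \<times> nat) pol \<Rightarrow> (nat \<times> nat) pol" where
  "wcomp w f = (\<Sum>a | a \<in> keys f \<and> mono_image snd a = w. single a (lookup f a))"

lemma lookup_wcomp: "lookup (wcomp w f) a = (if mono_image snd a = w then lookup f a else 0)"
  by (simp add: wcomp_def lookup_sum lookup_single when_def in_keys_iff)

text \<open>The torus element \<open>d\<close> multiplies the component of weight \<open>w\<close>
  by \<open>mon d w\<close>. As the resulting sum lies in \<open>K\<close> for all \<open>d\<close>,
  independence of characters modulo \<open>K\<close> isolates each component.\<close>

lemma wcomp_mem:
  assumes K: "pol.subspace K" "K \<subseteq> Vmod m k"
    and inv: "\<And>g f. g \<in> Umat k \<Longrightarrow> f \<in> K \<Longrightarrow> act g f \<in> K" and f: "f \<in> K"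
  shows "wcomp w f \<in> K"
proof (cases "w \<in> mono_image snd ` keys f")
  case True
  let ?W = "mono_image snd ` keys f"
  let ?T = "{d. (\<forall>s. cmod (d s) = 1) \<and> (\<forall>s\<ge>k. d s = 1)}"
  show ?thesis
  proof (rule characters_independent_mod[where W = ?W and T = ?T and \<chi> = "\<lambda>w d. mon d w"
        and m = "\<lambda>x y s. x s * y s" and e = "\<lambda>_. 1"])
    fix w w' :: "nat mono" assume w: "w \<in> ?W" "w' \<in> ?W" "w \<noteq> w'"
    then obtain s where s: "lookup w s \<noteq> lookup w' s" by (meson poly_mapping_eqI)
    \<comment> \<open>Weights occurring in \<open>f\<close> vanish from column \<open>k\<close> on,
      so two of them differ in a column where the torus element can be chosen freely.\<close>
    have "lookup w s = 0" if wW: "w \<in> ?W" and "k \<le> s" for w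
    proof -
      obtain a where a: "a \<in> keys f" "w = mono_image snd a" using wW by auto
      have "snd v \<noteq> s" if "v \<in> keys a" for v
      proof -
        have "v \<in> vars f" using a that by (auto simp: vars_def)
        moreover have "f \<in> Vmod m k" using f K by blast
        ultimately show ?thesis using Vmod_vars \<open>k \<le> s\<close> by fastforce
      qed
      then show ?thesis by (auto simp: a lookup_mono_image intro!: sum.neutral)
    qed
    with w s have "s < k" by (metis not_le)
    obtain \<zeta> where \<zeta>: "cmod \<zeta> = 1" "\<zeta> ^ lookup w s \<noteq> \<zeta> ^ lookup w' s"
      using exists_unit_power_neq[OF s] by auto
    show "\<exists>d\<in>?T. mon d w \<noteq> mon d w'"
      by (rule bexI[of _ "(\<lambda>_. 1)(s := \<zeta>)"]) (use \<zeta> \<open>s < k\<close> in \<open>auto simp: mon_update_one simp del: fun_upd_apply\<close>, auto)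
  next
    fix d assume d: "d \<in> ?T"
    have "(\<Sum>w\<in>?W. mon d w *\<^sub>P wcomp w f) = act (dmat d) f"
    proof (rule poly_mapping_eqI)
      fix a
      have "lookup (\<Sum>w\<in>?W. mon d w *\<^sub>P wcomp w f) a
          = (\<Sum>w\<in>?W. if w = mono_image snd a then mon d w * lookup f a else 0)"
        unfolding lookup_sum lookup_smul lookup_wcomp by (intro sum.cong refl) auto
      also have "\<dots> = mon d (mono_image snd a) * lookup f a"
        by (simp add: in_keys_iff) (metis imageI in_keys_iff)
      finally show "lookup (\<Sum>w\<in>?W. mon d w *\<^sub>P wcomp w f) a = lookup (act (dmat d) f) a"
        by (simp add: lookup_act_dmat mon_mono_image)
    qed
    then show "(\<Sum>w\<in>?W. mon d w *\<^sub>P wcomp w f) \<in> K"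
      using inv[OF dmat_Umat f, of d] d by simp
  qed (use K True in \<open>auto simp: mon_mult norm_mult\<close>)
next
  case False
  then have "wcomp w f = 0"
    by (intro poly_mapping_eqI) (auto simp: lookup_wcomp in_keys_iff image_iff)
  then show ?thesis using pol.subspace_0[OF K(1)] by simp
qed

text \<open>A monomial that does not vanish at the base point contains diagonal variables only, so
  its column degrees equal its row degrees, which are \<open>weight m\<close>.\<close>

lemma ev_idmat_wcomp:
  assumes f: "f \<in> Vmod m k"
  shows "ev idmat (wcomp (weight m) f) = ev idmat f"
proof -
  have "keys (wcomp (weight m) f) \<subseteq> keys f"
    by (auto simp: in_keys_iff lookup_wcomp split: if_splits)
  then have "ev idmat (wcomp (weight m) f) = (\<Sum>a\<in>keys f. lookup (wcomp (weight m) f) a * mon idmat a)"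
    by (intro ev_superset) auto
  also have "\<dots> = ev idmat f"
    unfolding ev_def
  proof (intro sum.cong refl)
    fix a assume a: "a \<in> keys f"
    show "lookup (wcomp (weight m) f) a * mon idmat a = lookup f a * mon idmat a"
    proof (cases "mon idmat a = 0")
      case False
      then have "idmat v \<noteq> 0" if "v \<in> keys a" for v
        using that by (auto simp: mon_def in_keys_iff)
      then have "fst v = snd v" if "v \<in> keys a" for v
        using that by (fastforce simp: idmat_def split: prod.splits if_splits)
      then have "mono_image snd a = mono_image fst a"
        by (simp add: mono_image_def)
      with Vmod_row_weight[OF f a] show ?thesis by (simp add: lookup_wcomp)
    qed simp
  qed
  finally show ?thesis .
qed

lemma invariant_subspaces_intersect:
  assumes K: "pol.subspace K" "K \<subseteq> Vmod m k" "\<And>g f. g \<in> Umat k \<Longrightarrow> f \<in> K \<Longrightarrow> act g f \<in> K"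
    and K': "pol.subspace K'" "K' \<subseteq> Vmod m k" "\<And>g f. g \<in> Umat k \<Longrightarrow> f \<in> K' \<Longrightarrow> act g f \<in> K'"
    and q: "length m \<le> k" and "f \<in> K" "f \<noteq> 0" "f' \<in> K'" "f' \<noteq> 0"
  shows "\<exists>\<phi>\<in>K \<inter> K'. \<phi> \<noteq> 0"
proof -
  have ex: "\<exists>\<phi>\<in>K. ev idmat \<phi> \<noteq> 0 \<and> (\<forall>a\<in>keys \<phi>. mono_image snd a = weight m)"
    if K: "pol.subspace K" "K \<subseteq> Vmod m k" "\<And>g f. g \<in> Umat k \<Longrightarrow> f \<in> K \<Longrightarrow> act g f \<in> K"
      and f: "f \<in> K" "f \<noteq> 0" for K f
  proof -
    obtain h where h: "h \<in> K" "ev idmat h \<noteq> 0"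
      using invariant_vanishing[OF K(2,3) q] f by blast
    then have "ev idmat (wcomp (weight m) h) \<noteq> 0" using ev_idmat_wcomp K by auto
    moreover have "wcomp (weight m) h \<in> K" using wcomp_mem[OF K h(1)] .
    ultimately show ?thesis by (auto simp: lookup_wcomp in_keys_iff split: if_splits)
  qed
  obtain \<phi> where \<phi>: "\<phi> \<in> K" "ev idmat \<phi> \<noteq> 0" "\<forall>a\<in>keys \<phi>. mono_image snd a = weight m"
    using ex[OF K \<open>f \<in> K\<close> \<open>f \<noteq> 0\<close>] by blast
  obtain \<psi> where \<psi>: "\<psi> \<in> K'" "ev idmat \<psi> \<noteq> 0" "\<forall>a\<in>keys \<psi>. mono_image snd a = weight m"
    using ex[OF K' \<open>f' \<in> K'\<close> \<open>f' \<noteq> 0\<close>] by blast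
  \<comment> \<open>Chosen so that the difference of the two weight vectors vanishes at the base
    point and hence identically.\<close>
  define c where "c = ev idmat \<phi> / ev idmat \<psi>"
  have "\<phi> - c *\<^sub>P \<psi> = 0"
  proof (rule weight_vector_eq_0[OF _ q])
    show "\<phi> - c *\<^sub>P \<psi> \<in> Vmod m k"
      using \<phi> \<psi> K K' by (intro pol.subspace_diff[OF subspace_Vmod] pol.subspace_scale[OF subspace_Vmod]) auto
    show "ev idmat (\<phi> - c *\<^sub>P \<psi>) = 0" using \<psi> by (simp add: c_def)
    show "mono_image snd a = weight m" if "a \<in> keys (\<phi> - c *\<^sub>P \<psi>)" for a
      using that \<phi>(3) \<psi>(3) by (auto simp: in_keys_iff lookup_minus)
  qed
  then have "\<phi> = c *\<^sub>P \<psi>" by simp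
  then have "\<phi> \<in> K'" using pol.subspace_scale[OF K'(1) \<psi>(1)] by simp
  with \<phi> show ?thesis by (metis IntI ev_0)
qed

section \<open>The intertwining operators defined by invariants\<close>

lemma pairing_w_injective:
  assumes t: "t \<in> Tmod ms m k" "\<And>g. g \<in> Umat k \<Longrightarrow> act_zw g t = t" "t \<noteq> 0"
    and q: "length m \<le> k" and f: "f \<in> Vmod m k" "pairing_w (lookup t) f = 0"
  shows "f = 0"
proof (rule ccontr)
  assume "f \<noteq> 0"
  define K where "K = {f \<in> Vmod m k. pairing_w (lookup t) f = 0}"
  define K' where "K' = {g \<in> Vmod m k. \<forall>f\<in>K. pairing g f = 0}"
  have K_inv: "act g f \<in> K" if g: "g \<in> Umat k" and f: "f \<in> K" for g f
  proof -
    \<comment> \<open>The equivariance of the contraction is phrased with the dual action;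
      \<open>act g\<close> is the dual action of the conjugate matrix, which fixes \<open>t\<close>
      too.\<close>
    have h: "cnj_mat g \<in> Umat k" using g by (rule Umat_cnj_mat)
    then have dual: "act_dual (cnj_mat g) f = act g f"
      by (simp add: act_dual_def contra_Umat)
    have "pairing_w (lookup t) (act g f) = 0"
      using pairing_w_act[OF h, of t f] t(2)[OF h] f by (simp add: dual K_def)
    then show ?thesis using act_Vmod[OF _ g] f by (simp add: K_def)
  qed
  have K: "pol.subspace K"
    using subspace_Vmod[of m k] unfolding K_def pol.subspace_def
    by (auto simp: pairing_w_add pairing_w_smul pairing_w_0)
  have K': "pol.subspace K'"
    using subspace_Vmod[of m k] unfolding K'_def pol.subspace_def
    by (auto simp: pairing_add_left pairing_smul_left)
  have K'_inv: "act g h \<in> K'" if g: "g \<in> Umat k" and h: "h \<in> K'" for g h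
  proof -
    have "pairing (act g h) f = 0" if "f \<in> K" for f
    proof -
      have "pairing (act g h) f = pairing (act g h) (act g (act (adj g) f))"
        by (simp add: act_act_adj(2)[OF g])
      also have "\<dots> = pairing h (act (adj g) f)" by (rule pairing_act_act[OF g])
      also have "\<dots> = 0" using h K_inv[OF Umat_adj[OF g] that] by (simp add: K'_def)
      finally show ?thesis .
    qed
    then show ?thesis using act_Vmod[OF _ g] h by (simp add: K'_def)
  qed
  obtain c where c: "lookup t c \<noteq> 0" using t(3) by (metis lookup_zero poly_mapping_eqI)
  have "lookup (zcoef (zpart c) t) (wpart c) \<noteq> 0" using c by simp
  then have "zcoef (zpart c) t \<noteq> 0" by (metis lookup_zero)
  moreover have "zcoef (zpart c) t \<in> K'"
    using zcoef_Tmod[OF t(1)] by (auto simp: K'_def K_def simp flip: lookup_pairing_w)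
  moreover have "f \<in> K" using f by (simp add: K_def)
  ultimately obtain \<phi> where "\<phi> \<in> K" "\<phi> \<in> K'" "\<phi> \<noteq> 0"
    using invariant_subspaces_intersect[of K m k K' f "zcoef (zpart c) t"] K K_inv K' K'_inv q \<open>f \<noteq> 0\<close>
    by (auto simp: K_def K'_def)
  then show False using pairing_self_eq_0[of \<phi>] by (simp add: K'_def)
qed

text \<open>One truncation computes the contractions with finitely many vectors at once. The extra
  bound \<open>k0\<close> lets it also accommodate a given group element, module or
  monomial.\<close>

lemma invariants_reduce:
  assumes I: "I \<in> invariants ms m" and "finite A"
  obtains t k where "k0 \<le> k" "length m \<le> k" "t \<in> Tmod ms m k" "\<And>g. g \<in> Umat k \<Longrightarrow> act_zw g t = t"
    "lookup t = truncate k I" "\<And>f. f \<in> A \<Longrightarrow> pairing_w I f = pairing_w (lookup t) f"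
proof -
  obtain l where l: "\<And>f v. f \<in> A \<Longrightarrow> v \<in> vars f \<Longrightarrow> snd v < l"
    using vars_columns_bound[OF \<open>finite A\<close>] by blast
  define k where "k = max (max k0 l) (sum_list (map length ms) + length m)"
  have k: "sum_list (map length ms) + length m \<le> k" "k0 \<le> k" "l \<le> k"
    by (auto simp: k_def)
  obtain t where t: "t \<in> Tmod ms m k" "\<And>g. g \<in> Umat k \<Longrightarrow> act_zw g t = t" "lookup t = truncate k I"
    using invariants_truncate[OF I k(1)] by blast
  have "pairing_w I f = pairing_w (lookup t) f" if "f \<in> A" for f
    unfolding t(3) using l[OF that] k(3) by (intro pairing_w_truncate[OF I]) fastforce
  with t k show ?thesis using that[of k t] by simp
qed

lemma pairing_w_invariant_add:
  assumes "I \<in> invariants ms m"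
  shows "pairing_w I (f + f') = pairing_w I f + pairing_w I f'"
proof -
  obtain t k where "\<And>g. g \<in> {f, f', f + f'} \<Longrightarrow> pairing_w I g = pairing_w (lookup t) g"
    using invariants_reduce[OF assms, of "{f, f', f + f'}" 0] by (metis finite.emptyI finite_insert)
  then show ?thesis by (simp add: pairing_w_add)
qed

lemma pairing_w_invariant_smul:
  assumes "I \<in> invariants ms m"
  shows "pairing_w I (c *\<^sub>P f) = cnj c *\<^sub>P pairing_w I f"
proof -
  obtain t k where "\<And>g. g \<in> {f, c *\<^sub>P f} \<Longrightarrow> pairing_w I g = pairing_w (lookup t) g"
    using invariants_reduce[OF assms, of "{f, c *\<^sub>P f}" 0] by (metis finite.emptyI finite_insert)
  then show ?thesis by (simp add: pairing_w_smul)
qed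

lemma pairing_w_invariant_sum:
  assumes I: "I \<in> invariants ms m"
  shows "pairing_w I (\<Sum>x\<in>A. c x *\<^sub>P F x) = (\<Sum>x\<in>A. cnj (c x) *\<^sub>P pairing_w I (F x))"
proof -
  have "pairing_w I 0 = 0" using pairing_w_invariant_smul[OF I, of 0 0] by simp
  then show ?thesis
    by (induction A rule: infinite_finite_induct)
      (simp_all add: pairing_w_invariant_add[OF I] pairing_w_invariant_smul[OF I])
qed

lemma pairing_w_invariant_mem:
  assumes "I \<in> invariants ms m"
  shows "pairing_w I f \<in> VZ_inf ms"
proof -
  obtain t k where "t \<in> Tmod ms m k" "\<And>g. g \<in> {f} \<Longrightarrow> pairing_w I g = pairing_w (lookup t) g"
    using invariants_reduce[OF assms, of "{f}" 0] by (metis finite.emptyI finite_insert)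
  then show ?thesis using pairing_w_Tmod unfolding VZ_inf_def by fastforce
qed

lemma pairing_w_invariant_act:
  assumes I: "I \<in> invariants ms m" and g: "g \<in> carrier U_inf"
  shows "pairing_w I (act_dual g f) = act g (pairing_w I f)"
proof -
  obtain l where l: "g \<in> Umat l" using g by (auto simp: U_inf_def)
  have "finite {f, act_dual g f}" by simp
  then obtain t k where t: "l \<le> k" "\<And>g. g \<in> Umat k \<Longrightarrow> act_zw g t = t"
    "\<And>h. h \<in> {f, act_dual g f} \<Longrightarrow> pairing_w I h = pairing_w (lookup t) h"
    using invariants_reduce[OF I, of "{f, act_dual g f}" l] by metis
  have "g \<in> Umat k" using Umat_mono[OF l t(1)] .
  with pairing_w_act[OF this, of t f] show ?thesis by (simp add: t)
qed

lemma pairing_w_invariant_injective: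
  assumes I: "I \<in> invariants ms m" "I \<noteq> 0" and f: "f \<in> V_inf m" "pairing_w I f = 0"
  shows "f = 0"
proof -
  obtain l where l: "f \<in> Vmod m l" using f by (auto simp: V_inf_def)
  obtain c where c: "I c \<noteq> 0" using I(2) by (auto simp: fun_eq_iff)
  have fin: "finite {f}" by simp
  \<comment> \<open>The bound covers the columns of a monomial \<open>c\<close> occurring in
    \<open>I\<close>, so that the truncation retains \<open>c\<close> and is nonzero.\<close>
  obtain t k where t: "max l (Suc (Max (snd ` keys c))) \<le> k" "length m \<le> k" "t \<in> Tmod ms m k"
    "\<And>g. g \<in> Umat k \<Longrightarrow> act_zw g t = t"
    "lookup t = truncate k I" "\<And>g. g \<in> {f} \<Longrightarrow> pairing_w I g = pairing_w (lookup t) g"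
    using invariants_reduce[OF I(1) fin, of "max l (Suc (Max (snd ` keys c)))"] by metis
  have "snd v < k" if "v \<in> keys c" for v
  proof -
    have "snd v \<le> Max (snd ` keys c)" using that by (intro Max_ge) auto
    with t(1) show ?thesis by simp
  qed
  then have "lookup t c \<noteq> 0" using c by (auto simp: t(5) truncate_def)
  then have "t \<noteq> 0" by auto
  moreover have "f \<in> Vmod m k" using Vmod_mono[of l k m] l t(1) by auto
  ultimately show ?thesis using pairing_w_injective[OF t(3,4) _ t(2)] t(6) f by auto
qed

lemma pairing_invariant:
  assumes I: "I \<in> invariants ms m"
  shows "pairing (pairing_w I f) u = pairing_ser I (tensor_zw u f)"
proof -
  obtain l where l: "\<And>v. v \<in> vars (tensor_zw u f) \<Longrightarrow> snd v < l"
    by (rule vars_columns_bound[of "{tensor_zw u f}"]) auto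
  have fin: "finite {f}" by simp
  obtain t k where t: "l \<le> k" "lookup t = truncate k I"
    "\<And>g. g \<in> {f} \<Longrightarrow> pairing_w I g = pairing_w (lookup t) g"
    using invariants_reduce[OF I fin, of l] by metis
  have "pairing (pairing_w I f) u = pairing t (tensor_zw u f)"
    by (simp add: t(3) pairing_pairing_w)
  also have "\<dots> = pairing_ser I (tensor_zw u f)"
    unfolding pairing_def t(2) using l t(1) by (intro pairing_ser_truncate[symmetric]) fastforce
  finally show ?thesis .
qed

text \<open>Independence concerns the image set; injectivity of the indexing transfers it to indexed
  coefficients.\<close>

lemma basis_coefficients_0:
  assumes "is_basis smul S f \<Xi>" and A: "finite A" "A \<subseteq> \<Xi>"
    and "(\<Sum>\<xi>\<in>A. c \<xi> *\<^sub>P f \<xi>) = 0" and "\<xi> \<in> A"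
  shows "c \<xi> = 0"
proof -
  have inj: "inj_on f A" and ind: "\<not> pol.dependent (f ` \<Xi>)"
    using assms(1) A by (auto simp: is_basis_def intro: inj_on_subset)
  have "(\<Sum>v\<in>f ` A. c (the_inv_into A f v) *\<^sub>P v) = (\<Sum>\<xi>\<in>A. c \<xi> *\<^sub>P f \<xi>)"
    by (simp add: sum.reindex[OF inj] the_inv_into_f_f[OF inj])
  then have "c (the_inv_into A f (f \<xi>)) = 0"
    using pol.independentD[OF ind, of "f ` A" "\<lambda>v. c (the_inv_into A f v)" "f \<xi>"] A assms(4,5)
    by auto
  then show ?thesis by (simp add: the_inv_into_f_f[OF inj \<open>\<xi> \<in> A\<close>])
qed

lemma span_family:
  assumes "v \<in> pol.span (f ` \<Xi>)" "inj_on f \<Xi>"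
  obtains A c where "finite A" "A \<subseteq> \<Xi>" "v = (\<Sum>\<xi>\<in>A. c \<xi> *\<^sub>P f \<xi>)"
proof -
  obtain B r where B: "finite B" "B \<subseteq> f ` \<Xi>" "v = (\<Sum>b\<in>B. r b *\<^sub>P b)"
    using assms(1) unfolding pol.span_explicit by blast
  obtain A where A: "finite A" "A \<subseteq> \<Xi>" "B = f ` A"
    using finite_subset_image[OF B(1,2)] by blast
  then have "inj_on f A" using assms(2) inj_on_subset by blast
  with B A show ?thesis using that[of A "\<lambda>\<xi>. r (f \<xi>)"] by (simp add: sum.reindex)
qed

theorem mainTheorem4:
  fixes ms :: "nat list list" and m :: "nat list"
    and X :: "nat \<Rightarrow> 'a set" and fs :: "nat \<Rightarrow> 'a \<Rightarrow> (nat \<times> nat) pol"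
    and \<Xi> :: "'x set" and f fstar :: "'x \<Rightarrow> (nat \<times> nat) pol"
    and D :: "(nat \<Rightarrow> nat \<Rightarrow> complex) \<Rightarrow> 'x \<Rightarrow> 'x \<Rightarrow> complex"
    and H :: "'e set" and I :: "'e \<Rightarrow> zwvar ser"
    and ftilde :: "'e \<Rightarrow> 'x \<Rightarrow> zvar pol"
  assumes "ms \<noteq> []" and "\<forall>i<length ms. signature (ms ! i)" and "signature m"
    and "\<forall>i<length ms. is_basis smul (V_inf (ms ! i)) (fs i) (X i)"
    and "is_basis smul (V_inf m) f \<Xi>"
    and "transforms_by act \<Xi> f D"
    and "is_basis smul (V_inf m) fstar \<Xi>"
    and "transforms_by act_dual \<Xi> fstar (\<lambda>g \<xi> \<xi>'. cnj (D g \<xi> \<xi>'))"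
    and "is_basis ser_smul (invariants ms m) I H"
  defines "ftilde \<equiv> \<lambda>\<eta> \<xi>. pairing_w (I \<eta>) (fstar \<xi>)"
  shows "(\<forall>\<eta> \<in> H.
            (\<forall>\<xi> \<in> \<Xi>. ftilde \<eta> \<xi> \<in> VZ_inf ms) \<and>
            (\<exists>L. Vector_Spaces.linear smul smul L \<and>
                 (\<forall>\<xi> \<in> \<Xi>. L (f \<xi>) = ftilde \<eta> \<xi>) \<and>
                 bij_betw L (pol.span (f ` \<Xi>)) (pol.span (ftilde \<eta> ` \<Xi>)) \<and>
                 (\<forall>g \<in> carrier U_inf. \<forall>v \<in> pol.span (f ` \<Xi>). L (act g v) = act g (L v))) \<and>
            transforms_by act \<Xi> (ftilde \<eta>) D) \<and>
         (\<forall>\<eta> \<in> H. \<forall>\<xi> \<in> \<Xi>. \<forall>x. (\<forall>i<length ms. x i \<in> X i) \<longrightarrow>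
            pairing (ftilde \<eta> \<xi>) (tensor_z (length ms) (\<lambda>i. fs i (x i)))
              = pairing_ser (I \<eta>)
                  (tensor_zw (tensor_z (length ms) (\<lambda>i. fs i (x i))) (fstar \<xi>)))"
proof (intro conjI ballI allI impI)
  fix \<eta> assume "\<eta> \<in> H"
  then have I: "I \<eta> \<in> invariants ms m"
    using assms(9) ser.span_base[of "I \<eta>" "I ` H"] by (auto simp: is_basis_def)
  have "\<not> ser.dependent (I ` H)" using assms(9) by (simp add: is_basis_def)
  then have I0: "I \<eta> \<noteq> 0" using ser.dependent_zero[of "I ` H"] \<open>\<eta> \<in> H\<close> by force
  show "ftilde \<eta> \<xi> \<in> VZ_inf ms" for \<xi>
    unfolding ftilde_def using I by (rule pairing_w_invariant_mem)
  show "pairing (ftilde \<eta> \<xi>) u = pairing_ser (I \<eta>) (tensor_zw u (fstar \<xi>))" for \<xi> u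
    unfolding ftilde_def using I by (rule pairing_invariant)
  show trans: "transforms_by act \<Xi> (ftilde \<eta>) D"
    unfolding transforms_by_def
  proof (intro ballI conjI)
    fix g \<xi> assume g: "g \<in> carrier U_inf" and \<xi>: "\<xi> \<in> \<Xi>"
    have D: "act_dual g (fstar \<xi>) = (\<Sum>\<xi>' | \<xi>' \<in> \<Xi> \<and> D g \<xi> \<xi>' \<noteq> 0. cnj (D g \<xi> \<xi>') *\<^sub>P fstar \<xi>')"
      "finite {\<xi>' \<in> \<Xi>. D g \<xi> \<xi>' \<noteq> 0}"
      using assms(8) g \<xi> by (auto simp: transforms_by_def)
    show "finite {\<xi>' \<in> \<Xi>. D g \<xi> \<xi>' \<noteq> 0}" by fact
    show "act g (ftilde \<eta> \<xi>) = (\<Sum>\<xi>' | \<xi>' \<in> \<Xi> \<and> D g \<xi> \<xi>' \<noteq> 0. D g \<xi> \<xi>' *\<^sub>P ftilde \<eta> \<xi>')"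
      unfolding ftilde_def pairing_w_invariant_act[OF I g, symmetric] D
      by (simp add: pairing_w_invariant_sum[OF I])
  qed
  have inj_f: "inj_on f \<Xi>" and ind_f: "\<not> pol.dependent (f ` \<Xi>)"
    using assms(5) by (auto simp: is_basis_def)
  interpret pair: vector_space_pair "smul :: complex \<Rightarrow> (nat \<times> nat) pol \<Rightarrow> _" "smul :: complex \<Rightarrow> zvar pol \<Rightarrow> _"
    by unfold_locales
  \<comment> \<open>The linear extension of the prescribed values on the basis; injectivity of
    \<open>f\<close> makes the index of a basis vector well defined.\<close>
  define L where "L = pair.construct (f ` \<Xi>) (\<lambda>v. ftilde \<eta> (the_inv_into \<Xi> f v))"
  have lin: "Vector_Spaces.linear smul smul L"
    unfolding L_def by (rule pair.linear_construct[OF ind_f])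
  interpret L: Vector_Spaces.linear smul smul L by (rule lin)
  have Lf: "L (f \<xi>) = ftilde \<eta> \<xi>" if "\<xi> \<in> \<Xi>" for \<xi>
    unfolding L_def using that
    by (simp add: pair.construct_basis[OF ind_f] the_inv_into_f_f[OF inj_f])
  have L_inj: "v = 0" if v: "v \<in> pol.span (f ` \<Xi>)" "L v = 0" for v
  proof -
    obtain A c where A: "finite A" "A \<subseteq> \<Xi>" "v = (\<Sum>\<xi>\<in>A. c \<xi> *\<^sub>P f \<xi>)"
      by (rule span_family[OF v(1) inj_f])
    have fstar: "fstar \<xi> \<in> V_inf m" if "\<xi> \<in> \<Xi>" for \<xi>
      using assms(7) pol.span_base[of "fstar \<xi>" "fstar ` \<Xi>"] that by (auto simp: is_basis_def)
    have "L v = (\<Sum>\<xi>\<in>A. c \<xi> *\<^sub>P ftilde \<eta> \<xi>)"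
      using A(2) by (auto simp: A(3) L.sum L.scale Lf intro!: sum.cong)
    \<comment> \<open>Conjugate linearity of the contraction turns the coefficients into their
      conjugates on the dual basis, whose independence then gives
      \<open>c \<xi> = 0\<close>.\<close>
    also have "\<dots> = pairing_w (I \<eta>) (\<Sum>\<xi>\<in>A. cnj (c \<xi>) *\<^sub>P fstar \<xi>)"
      by (simp add: pairing_w_invariant_sum[OF I] ftilde_def)
    finally have "pairing_w (I \<eta>) (\<Sum>\<xi>\<in>A. cnj (c \<xi>) *\<^sub>P fstar \<xi>) = 0" using v(2) by simp
    moreover have "(\<Sum>\<xi>\<in>A. cnj (c \<xi>) *\<^sub>P fstar \<xi>) \<in> V_inf m"
      using A(2) fstar by (intro pol.subspace_sum[OF subspace_V_inf] pol.subspace_scale[OF subspace_V_inf]) auto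
    ultimately have "(\<Sum>\<xi>\<in>A. cnj (c \<xi>) *\<^sub>P fstar \<xi>) = 0"
      using pairing_w_invariant_injective[OF I I0] by blast
    then have "cnj (c \<xi>) = 0" if "\<xi> \<in> A" for \<xi>
      using basis_coefficients_0[OF assms(7) A(1,2), of "\<lambda>\<xi>. cnj (c \<xi>)"] that by simp
    then show ?thesis by (simp add: A(3))
  qed
  show "\<exists>L. Vector_Spaces.linear smul smul L \<and>
         (\<forall>\<xi> \<in> \<Xi>. L (f \<xi>) = ftilde \<eta> \<xi>) \<and>
         bij_betw L (pol.span (f ` \<Xi>)) (pol.span (ftilde \<eta> ` \<Xi>)) \<and>
         (\<forall>g \<in> carrier U_inf. \<forall>v \<in> pol.span (f ` \<Xi>). L (act g v) = act g (L v))"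
  proof (intro exI[of _ L] conjI ballI lin Lf)
    have "L ` f ` \<Xi> = ftilde \<eta> ` \<Xi>" using Lf by (auto simp: image_iff)
    then have "L ` pol.span (f ` \<Xi>) = pol.span (ftilde \<eta> ` \<Xi>)"
      using L.span_image[of "f ` \<Xi>"] by simp
    moreover have "inj_on L (pol.span (f ` \<Xi>))"
    proof (rule inj_onI)
      fix x y assume "x \<in> pol.span (f ` \<Xi>)" "y \<in> pol.span (f ` \<Xi>)" "L x = L y"
      then show "x = y" using L_inj[of "x - y"] by (simp add: pol.span_diff L.diff)
    qed
    ultimately show "bij_betw L (pol.span (f ` \<Xi>)) (pol.span (ftilde \<eta> ` \<Xi>))"
      by (simp add: bij_betw_def)
  next
    fix g v assume g: "g \<in> carrier U_inf" and "v \<in> pol.span (f ` \<Xi>)"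
    from this(2) show "L (act g v) = act g (L v)"
    proof (induction rule: pol.span_induct)
      show "pol.subspace {v. L (act g v) = act g (L v)}"
        by (auto simp: pol.subspace_def act_add act_smul L.add L.scale L.zero)
    next
      fix v assume "v \<in> f ` \<Xi>"
      then obtain \<xi> where \<xi>: "\<xi> \<in> \<Xi>" "v = f \<xi>" by auto
      \<comment> \<open>Equivariance on basis vectors is the equality of the two transformation
        laws: \<open>f\<close> and \<open>ftilde \<eta>\<close> transform with the same
        \<open>D\<close>.\<close>
      have "L (act g (f \<xi>)) = (\<Sum>\<xi>' | \<xi>' \<in> \<Xi> \<and> D g \<xi> \<xi>' \<noteq> 0. D g \<xi> \<xi>' *\<^sub>P ftilde \<eta> \<xi>')"
        using assms(6) g \<xi>(1) by (auto simp: transforms_by_def L.sum L.scale Lf intro!: sum.cong)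
      also have "\<dots> = act g (ftilde \<eta> \<xi>)"
        using trans g \<xi>(1) by (simp add: transforms_by_def)
      finally show "L (act g v) = act g (L v)" by (simp add: \<xi> Lf)
    qed
  qed
qed

end
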